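(* Let $T>0$, let $u_0\in H^1(\mathbb{R})\cap W^{1,\infty}(\mathbb{R})$, and let $u=u(x,t)$ be a real-valued solution of the initial value problem for the Camassa-Holm equation $$\partial_t u+u\,\partial_x u+\partial_x(1-\partial_x^2)^{-1}\Big(u^2+\tfrac12(\partial_x u)^2\Big)=0,\qquad x\in\mathbb{R},\ t\in[0,T],\qquad u(\cdot,0)=u_0,$$ in the class $$u\in C([0,T]:H^1(\mathbb{R}))\cap L^\infty([0,T]:W^{1,\infty}(\mathbb{R}))\cap C^1((0,T):L^2(\mathbb{R})).$$ If there exists a nonempty open set $\Omega\subset\mathbb{R}\times[0,T]$ such that $u(x,t)=0$ for all $(x,t)\in\Omega$, then $u(x,t)=0$ for all $(x,t)\in\mathbb{R}\times[0,T]$.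
   Context: $C([0,T]:Y)$, $C^1((0,T):Y)$, $L^\infty([0,T]:Y)$ denote the spaces of continuous, continuously differentiable, and essentially bounded functions of $t$ with values in the Banach space $Y$. $W^{1,\infty}(\mathbb{R})$ is the space of bounded Lipschitz functions. The operator $(1-\partial_x^2)^{-1}$ on $\mathbb{R}$ is convolution with $\frac12 e^{-|x|}$, so $\partial_x(1-\partial_x^2)^{-1}$ is convolution with $-\frac12\operatorname{sgn}(x)e^{-|x|}$. The equation is understood as an identity in $L^2(\mathbb{R})$ for each $t\in(0,T)$. Since $u(\cdot,t)\in H^1(\mathbb{R})$, $u$ is identified with its continuous representative. *)

theory Defs
  imports "HOL-Analysis.Analysis"
begin

text \<open>
  Elements of function spaces on the real line are represented by honest functions
  \<open>real \<Rightarrow> real\<close>; a curve \<open>u\<close> in such a space has the type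
  \<open>real \<Rightarrow> real \<Rightarrow> real\<close> with time as its first argument, i.e. \<open>u t x\<close> stands for
  \<open>u(x,t)\<close>. Only the values for \<open>t\<close> in the relevant time interval matter.
\<close>

definition L2 :: "(real \<Rightarrow> real) set" where
  "L2 = {f. f \<in> borel_measurable lborel \<and> integrable lborel (\<lambda>x. (f x)\<^sup>2)}"

definition L2_norm :: "(real \<Rightarrow> real) \<Rightarrow> real" where
  "L2_norm f = sqrt (\<integral>x. (f x)\<^sup>2 \<partial>lborel)"

definition test_function :: "(real \<Rightarrow> real) \<Rightarrow> bool" where
  "test_function \<phi> \<longleftrightarrow>
     (\<forall>n x. (deriv ^^ n) \<phi> field_differentiable at x) \<and>
     (\<exists>R. \<forall>x. \<bar>x\<bar> > R \<longrightarrow> \<phi> x = 0)"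

text \<open>
  The distributional derivative of \<open>f\<close> is \<open>g\<close>. This is only used for \<open>f\<close> in \<open>L2\<close>, so that
  both integrals below exist.
\<close>
definition has_weak_L2_deriv :: "(real \<Rightarrow> real) \<Rightarrow> (real \<Rightarrow> real) \<Rightarrow> bool" where
  "has_weak_L2_deriv f g \<longleftrightarrow> g \<in> L2 \<and>
     (\<forall>\<phi>. test_function \<phi> \<longrightarrow>
        (\<integral>x. f x * deriv \<phi> x \<partial>lborel) = - (\<integral>x. g x * \<phi> x \<partial>lborel))"

definition H1 :: "(real \<Rightarrow> real) set" where
  "H1 = {f \<in> L2. \<exists>g. has_weak_L2_deriv f g}"

text \<open>The weak derivative is determined up to null sets; some representative is chosen.\<close>
definition weak_deriv :: "(real \<Rightarrow> real) \<Rightarrow> real \<Rightarrow> real" where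
  "weak_deriv f = (SOME g. has_weak_L2_deriv f g)"

definition H1_norm :: "(real \<Rightarrow> real) \<Rightarrow> real" where
  "H1_norm f = sqrt ((L2_norm f)\<^sup>2 + (L2_norm (weak_deriv f))\<^sup>2)"

definition W1inf :: "(real \<Rightarrow> real) set" where
  "W1inf = {f. bounded (range f) \<and> (\<exists>L. L-lipschitz_on UNIV f)}"

text \<open>The least Lipschitz constant is the essential supremum of the derivative.\<close>
definition W1inf_norm :: "(real \<Rightarrow> real) \<Rightarrow> real" where
  "W1inf_norm f = (SUP x. \<bar>f x\<bar>) + Inf {L. L-lipschitz_on UNIV f}"

text \<open>
  Curves in a space \<open>Y\<close> of functions that is normed by \<open>N\<close>.
\<close>
definition C0_curve ::
  "(real \<Rightarrow> real) set \<Rightarrow> ((real \<Rightarrow> real) \<Rightarrow> real) \<Rightarrow> real set \<Rightarrow> (real \<Rightarrow> real \<Rightarrow> real) \<Rightarrow> bool" where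
  "C0_curve Y N I u \<longleftrightarrow>
     (\<forall>t\<in>I. u t \<in> Y) \<and>
     (\<forall>t\<in>I. ((\<lambda>s. N (\<lambda>x. u s x - u t x)) \<longlongrightarrow> 0) (at t within I))"

definition has_curve_deriv ::
  "(real \<Rightarrow> real) set \<Rightarrow> ((real \<Rightarrow> real) \<Rightarrow> real) \<Rightarrow> real set \<Rightarrow> (real \<Rightarrow> real \<Rightarrow> real) \<Rightarrow>
     (real \<Rightarrow> real) \<Rightarrow> real \<Rightarrow> bool" where
  "has_curve_deriv Y N I u v t \<longleftrightarrow>
     v \<in> Y \<and>
     ((\<lambda>s. N (\<lambda>x. (u s x - u t x) / (s - t) - v x)) \<longlongrightarrow> 0) (at t within I)"

definition C1_curve ::
  "(real \<Rightarrow> real) set \<Rightarrow> ((real \<Rightarrow> real) \<Rightarrow> real) \<Rightarrow> real set \<Rightarrow> (real \<Rightarrow> real \<Rightarrow> real) \<Rightarrow> bool" where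
  "C1_curve Y N I u \<longleftrightarrow>
     (\<forall>t\<in>I. u t \<in> Y) \<and>
     (\<exists>v. C0_curve Y N I v \<and> (\<forall>t\<in>I. has_curve_deriv Y N I u (v t) t))"

text \<open>
  No strong (Bochner) measurability into \<open>Y\<close> is demanded: for the non-separable space
  \<open>W1inf\<close> it would exclude translating peakons, and the usual meaning of
  \<open>L\<^sup>\<infinity>([0,T]:W\<^sup>1\<^sup>,\<^sup>\<infinity>)\<close> is the essential bound on the norm.
\<close>
definition Linf_curve ::
  "(real \<Rightarrow> real) set \<Rightarrow> ((real \<Rightarrow> real) \<Rightarrow> real) \<Rightarrow> real set \<Rightarrow> (real \<Rightarrow> real \<Rightarrow> real) \<Rightarrow> bool" where
  "Linf_curve Y N I u \<longleftrightarrow> (\<exists>C. AE t in lborel. t \<in> I \<longrightarrow> u t \<in> Y \<and> N (u t) \<le> C)"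

definition convolve :: "(real \<Rightarrow> real) \<Rightarrow> (real \<Rightarrow> real) \<Rightarrow> real \<Rightarrow> real" where
  "convolve k f x = (\<integral>y. k (x - y) * f y \<partial>lborel)"

text \<open>The operator \<open>\<partial>\<^sub>x (1 - \<partial>\<^sub>x\<^sup>2)\<^sup>-\<^sup>1\<close>.\<close>
definition dx_inv_Helmholtz :: "(real \<Rightarrow> real) \<Rightarrow> real \<Rightarrow> real" where
  "dx_inv_Helmholtz = convolve (\<lambda>x. - (1/2) * sgn x * exp (- \<bar>x\<bar>))"

text \<open>
  The Camassa-Holm equation at time \<open>t\<close> as an identity between elements of \<open>L2\<close>, where
  \<open>v\<close> is the time derivative of \<open>u\<close> at \<open>t\<close> in \<open>L2\<close>.
\<close>
definition CH_equation_at :: "real \<Rightarrow> (real \<Rightarrow> real \<Rightarrow> real) \<Rightarrow> real \<Rightarrow> bool" where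
  "CH_equation_at T u t \<longleftrightarrow>
     (\<exists>v. has_curve_deriv L2 L2_norm {0<..<T} u v t \<and>
        (AE x in lborel.
           v x + u t x * weak_deriv (u t) x
             + dx_inv_Helmholtz (\<lambda>y. (u t y)\<^sup>2 + 1/2 * (weak_deriv (u t) y)\<^sup>2) x = 0))"

text \<open>
  Continuity of each \<open>u t\<close> says that \<open>u t\<close> is the continuous representative of its class.
\<close>
definition CH_solution ::
  "real \<Rightarrow> (real \<Rightarrow> real) \<Rightarrow> (real \<Rightarrow> real \<Rightarrow> real) \<Rightarrow> bool" where
  "CH_solution T u0 u \<longleftrightarrow>
     (\<forall>t\<in>{0..T}. continuous_on UNIV (u t)) \<and>
     C0_curve H1 H1_norm {0..T} u \<and>
     Linf_curve W1inf W1inf_norm {0..T} u \<and>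
     C1_curve L2 L2_norm {0<..<T} u \<and>
     u 0 = u0 \<and>
     (\<forall>t\<in>{0<..<T}. CH_equation_at T u t)"

end

theory Submission
  imports Defs
begin

text \<open>
  The nonlocal term turns local vanishing into global vanishing. Let \<open>u\<close> vanish on a rectangle
  \<open>(a, b) \<times> (t - \<delta>, t + \<delta>)\<close>. There \<open>\<partial>\<^sub>t u\<close> and \<open>u \<partial>\<^sub>x u\<close> vanish, so by the equation
  \<open>F = \<partial>\<^sub>x (1 - \<partial>\<^sub>x\<^sup>2)\<^sup>-\<^sup>1 f\<close> vanishes on \<open>(a, b)\<close> as well, where \<open>f = u\<^sup>2 + (\<partial>\<^sub>x u)\<^sup>2 / 2\<close>. Here \<open>f\<close> is
  nonnegative and zero on \<open>(a, b)\<close>. For \<open>p < q\<close> in \<open>(a, b)\<close> the difference \<open>F q - F p\<close> is the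
  integral of \<open>f\<close> against \<open>k (q - y) - k (p - y)\<close> with \<open>k x = - sgn x exp (- \<bar>x\<bar>) / 2\<close>, and that
  weight is strictly positive for \<open>y\<close> outside \<open>[p, q]\<close>. Hence \<open>f = 0\<close> almost everywhere, that is,
  \<open>u (\<cdot>, t) = 0\<close> (\<open>dx_inv_Helmholtz_unique_continuation\<close>, \<open>CH_zero_on_rectangle\<close>).

  It remains to see that a solution that is zero at one time is zero at all times, before and after
  (\<open>CH_zero_propagates\<close>). A Gronwall argument for the energy \<open>\<parallel>u\<parallel>\<^sup>2 + \<parallel>\<partial>\<^sub>x u\<parallel>\<^sup>2\<close> in \<open>L\<^sup>2\<close> would show this,
  but the solution has no second derivative in space with which the energy could be differentiated
  in time. The derivative is therefore replaced by the difference quotient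
  \<open>D\<^sub>h u = (u (\<cdot> + h) - u) / h\<close>. The discrete energy \<open>\<parallel>u\<parallel>\<^sup>2 + \<parallel>D\<^sub>h u\<parallel>\<^sup>2\<close> is differentiable in
  time, and its rate is at most \<open>12 M\<close> times the energy, uniformly in \<open>h\<close>, if \<open>M\<close> bounds \<open>\<bar>u\<bar>\<close> and
  the Lipschitz constant of \<open>u\<close> in space (\<open>energy_rate\<close>). Two facts give the uniformity: after an
  integration by parts (\<open>integral_product_derivative\<close>) the transport term contains no derivative of
  \<open>D\<^sub>h u\<close>, and \<open>k\<close>, though discontinuous, has translates with
  \<open>\<integral>\<bar>k (x + h) - k x\<bar> dx \<le> 3 h\<close>, so that \<open>D\<^sub>h F\<close> is bounded in \<open>L\<^sup>1\<close> by \<open>f\<close>. As the energy is the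
  supremum of the discrete energies, Gronwall's inequality can be applied to the whole family
  (\<open>approximate_Gronwall\<close>).

  The analysis of functions with a weak derivative in \<open>L\<^sup>2\<close> rests on the fundamental theorem of
  calculus (\<open>weak_derivative_FTC\<close>), obtained by testing with smooth approximations of the indicator
  of an interval, and on the convergence of difference quotients in \<open>L\<^sup>2\<close> (\<open>diff_quot_tendsto\<close>),
  which follows from the density of continuous functions with compact support. In particular weak
  derivatives are unique almost everywhere, so the choice made in \<open>weak_deriv\<close> does not matter.
\<close>

section \<open>The space of square integrable functions\<close>

lemma L2_measurable: "f \<in> L2 \<Longrightarrow> f \<in> borel_measurable borel"
  by (simp add: L2_def)

lemma L2_square_integrable: "f \<in> L2 \<Longrightarrow> integrable lborel (\<lambda>x. (f x)\<^sup>2)"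
  by (simp add: L2_def)

lemma L2_dominated:
  assumes "f \<in> L2" and [measurable]: "g \<in> borel_measurable borel" and "\<And>x. \<bar>g x\<bar> \<le> B * \<bar>f x\<bar>"
  shows "g \<in> L2"
proof -
  have *: "integrable lborel (\<lambda>x. B\<^sup>2 * (f x)\<^sup>2)"
    using assms by (simp add: L2_def)
  have le: "(g x)\<^sup>2 \<le> B\<^sup>2 * (f x)\<^sup>2" for x
    using power_mono[OF assms(3)[of x], of 2] by (simp add: power_mult_distrib)
  have "integrable lborel (\<lambda>x. (g x)\<^sup>2)"
  proof (rule Bochner_Integration.integrable_bound[OF *])
    show "AE x in lborel. norm ((g x)\<^sup>2) \<le> norm (B\<^sup>2 * (f x)\<^sup>2)"
      by (rule AE_I2) (use le in \<open>simp add: abs_mult\<close>)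
  qed simp
  then show ?thesis by (simp add: L2_def)
qed

lemma L2_mult_integrable:
  assumes "f \<in> L2" "g \<in> L2"
  shows "integrable lborel (\<lambda>x. f x * g x)"
proof (rule Bochner_Integration.integrable_bound)
  show "integrable lborel (\<lambda>x. (f x)\<^sup>2 + (g x)\<^sup>2)"
    using assms by (simp add: L2_def)
  show "(\<lambda>x. f x * g x) \<in> borel_measurable lborel"
    using assms by (auto simp: L2_def)
  show "AE x in lborel. norm (f x * g x) \<le> norm ((f x)\<^sup>2 + (g x)\<^sup>2)"
  proof (rule AE_I2)
    fix x
    have "0 \<le> (\<bar>f x\<bar> - \<bar>g x\<bar>)\<^sup>2" "0 \<le> (f x)\<^sup>2" "0 \<le> (g x)\<^sup>2" by auto
    then have "2 * (\<bar>f x\<bar> * \<bar>g x\<bar>) \<le> (f x)\<^sup>2 + (g x)\<^sup>2" "0 \<le> \<bar>f x\<bar> * \<bar>g x\<bar>"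
      by (auto simp: power2_diff)
    then show "norm (f x * g x) \<le> norm ((f x)\<^sup>2 + (g x)\<^sup>2)"
      unfolding real_norm_def abs_mult by linarith
  qed
qed

lemma L2_add: assumes "f \<in> L2" "g \<in> L2" shows "(\<lambda>x. f x + g x) \<in> L2"
proof -
  have "integrable lborel (\<lambda>x. (f x)\<^sup>2 + 2 * (f x * g x) + (g x)\<^sup>2)"
    using assms L2_mult_integrable[OF assms] by (simp add: L2_def)
  moreover have "(\<lambda>x. (f x + g x)\<^sup>2) = (\<lambda>x. (f x)\<^sup>2 + 2 * (f x * g x) + (g x)\<^sup>2)"
    by (simp add: power2_sum algebra_simps)
  ultimately show ?thesis using assms by (auto simp: L2_def)
qed

lemma L2_cmult: "f \<in> L2 \<Longrightarrow> (\<lambda>x. c * f x) \<in> L2"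
proof (rule L2_dominated[of f _ "\<bar>c\<bar>"])
  assume f: "f \<in> L2"
  then show "f \<in> L2" .
  show "(\<lambda>x. c * f x) \<in> borel_measurable borel" using L2_measurable[OF f] by simp
  show "\<bar>c * f x\<bar> \<le> \<bar>c\<bar> * \<bar>f x\<bar>" for x by (simp add: abs_mult)
qed

lemma L2_divide: "f \<in> L2 \<Longrightarrow> (\<lambda>x. f x / c) \<in> L2"
  using L2_cmult[of f "inverse c"] by (simp add: divide_inverse_commute)

lemma L2_diff: assumes "f \<in> L2" "g \<in> L2" shows "(\<lambda>x. f x - g x) \<in> L2"
  using L2_add[OF assms(1) L2_cmult[OF assms(2), of "-1"]] by simp

lemma L2_mult_bounded:
  assumes "f \<in> L2" "g \<in> borel_measurable borel" "\<And>x. \<bar>g x\<bar> \<le> B"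
  shows "(\<lambda>x. g x * f x) \<in> L2"
proof (rule L2_dominated[OF assms(1), where B=B])
  show "(\<lambda>x. g x * f x) \<in> borel_measurable borel"
    using assms(2) L2_measurable[OF assms(1)] by simp
  show "\<bar>g x * f x\<bar> \<le> B * \<bar>f x\<bar>" for x
    unfolding abs_mult by (rule mult_right_mono[OF assms(3)]) simp
qed

lemma integrable_shift:
  fixes f :: "real \<Rightarrow> real"
  assumes "integrable lborel f" shows "integrable lborel (\<lambda>x. f (x + h))"
  using lborel_integrable_real_affine[OF assms, of 1 h] by (simp add: add.commute)

lemma integral_shift: fixes f :: "real \<Rightarrow> real" shows "(\<integral>x. f (x + h) \<partial>lborel) = (\<integral>x. f x \<partial>lborel)"
  using lborel_integral_real_affine[of 1 f h] by (simp add: add.commute)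

lemma L2_shift: "f \<in> L2 \<Longrightarrow> (\<lambda>x. f (x + h)) \<in> L2"
  using integrable_shift[of "\<lambda>x. (f x)\<^sup>2" h] by (auto simp: L2_def)

lemma L2_indicator: "(indicator {a..b} :: real \<Rightarrow> real) \<in> L2"
proof -
  have "(\<lambda>x. (indicator {a..b} x)\<^sup>2) = (indicator {a..b} :: real \<Rightarrow> real)" by (auto simp: indicator_def)
  moreover have "integrable lborel (indicator {a..b} :: real \<Rightarrow> real)" by (rule integrable_real_indicator) (auto simp: emeasure_lborel_Icc_eq)
  ultimately show ?thesis by (simp add: L2_def)
qed

lemma L2_norm_nonneg [simp]: "0 \<le> L2_norm f"
  by (simp add: L2_norm_def)

lemma L2_norm_square: "(L2_norm f)\<^sup>2 = (\<integral>x. (f x)\<^sup>2 \<partial>lborel)"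
  by (simp add: L2_norm_def)

lemma L2_norm_shift: "L2_norm (\<lambda>x. f (x + h)) = L2_norm f"
  using integral_shift[of "\<lambda>x. (f x)\<^sup>2" h] by (simp add: L2_norm_def)

lemma L2_norm_cmult: "L2_norm (\<lambda>x. c * f x) = \<bar>c\<bar> * L2_norm f"
  by (simp add: L2_norm_def power_mult_distrib real_sqrt_mult)

lemma L2_norm_divide: "L2_norm (\<lambda>x. f x / c) = L2_norm f / \<bar>c\<bar>"
  using L2_norm_cmult[of "1 / c" f] by simp

lemma L2_norm_minus_commute: "L2_norm (\<lambda>x. f x - g x) = L2_norm (\<lambda>x. g x - f x)"
  by (simp add: L2_norm_def power2_commute)

lemma L2_norm_cong_AE:
  assumes "AE x in lborel. f x = g x" "f \<in> L2" "g \<in> L2"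
  shows "L2_norm f = L2_norm g"
  unfolding L2_norm_def using assms by (intro arg_cong[where f=sqrt] integral_cong_AE)
    (auto intro!: borel_measurable_power simp: L2_measurable)

lemma L2_Cauchy_Schwarz:
  assumes "f \<in> L2" "g \<in> L2"
  shows "\<bar>\<integral>x. f x * g x \<partial>lborel\<bar> \<le> L2_norm f * L2_norm g"
proof -
  define a b c where "a = (\<integral>x. (f x)\<^sup>2 \<partial>lborel)" and "b = (\<integral>x. f x * g x \<partial>lborel)"
    and "c = (\<integral>x. (g x)\<^sup>2 \<partial>lborel)"
  note int = L2_square_integrable[OF assms(1)] L2_square_integrable[OF assms(2)] L2_mult_integrable[OF assms]
  \<comment> \<open>The square of \<open>r f + s g\<close> has a nonnegative integral; the discriminant of this form is the claim.\<close>
  have quad: "0 \<le> a * r\<^sup>2 + 2 * b * r * s + c * s\<^sup>2" for r s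
  proof -
    have "0 \<le> (\<integral>x. (r * f x + s * g x)\<^sup>2 \<partial>lborel)" by simp
    also have "\<dots> = (\<integral>x. r\<^sup>2 * (f x)\<^sup>2 + (2 * r * s) * (f x * g x) + s\<^sup>2 * (g x)\<^sup>2 \<partial>lborel)"
      by (intro Bochner_Integration.integral_cong) (auto simp: power2_sum power_mult_distrib algebra_simps)
    also have "\<dots> = a * r\<^sup>2 + 2 * b * r * s + c * s\<^sup>2"
      using int by (simp add: a_def b_def c_def)
    finally show ?thesis .
  qed
  have ac: "a \<ge> 0" "c \<ge> 0" by (auto simp: a_def c_def)
  have "b\<^sup>2 \<le> a * c"
  proof (cases "c = 0")
    case True
    have "b = 0"
    proof (rule ccontr)
      assume "b \<noteq> 0"
      then show False using quad[of 1 "- (a + 1) / (2 * b)"] True by (simp add: field_simps)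
    qed
    then show ?thesis using True by simp
  next
    case False
    have "0 \<le> c * (a * c - b\<^sup>2)" using quad[of c "-b"] by (simp add: power2_eq_square algebra_simps)
    then show ?thesis using False ac by (simp add: zero_le_mult_iff)
  qed
  then have "sqrt (b\<^sup>2) \<le> sqrt (a * c)" by (rule real_sqrt_le_mono)
  then show ?thesis by (simp add: real_sqrt_mult L2_norm_def a_def b_def c_def)
qed

lemma L2_norm_add:
  assumes "f \<in> L2" "g \<in> L2"
  shows "L2_norm (\<lambda>x. f x + g x) \<le> L2_norm f + L2_norm g"
proof -
  note int = L2_square_integrable[OF assms(1)] L2_square_integrable[OF assms(2)] L2_mult_integrable[OF assms]
  have "(L2_norm (\<lambda>x. f x + g x))\<^sup>2 = (\<integral>x. (f x)\<^sup>2 + 2 * (f x * g x) + (g x)\<^sup>2 \<partial>lborel)"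
    unfolding L2_norm_square by (intro Bochner_Integration.integral_cong) (auto simp: power2_sum)
  also have "\<dots> = (L2_norm f)\<^sup>2 + 2 * (\<integral>x. f x * g x \<partial>lborel) + (L2_norm g)\<^sup>2"
    using int by (simp add: L2_norm_square)
  also have "\<dots> \<le> (L2_norm f + L2_norm g)\<^sup>2"
    using L2_Cauchy_Schwarz[OF assms] by (simp add: power2_sum)
  finally show ?thesis by (rule power2_le_imp_le) simp
qed

lemma L2_norm_triangle:
  assumes "f \<in> L2" "g \<in> L2" "k \<in> L2"
  shows "L2_norm (\<lambda>x. f x - g x) \<le> L2_norm (\<lambda>x. f x - k x) + L2_norm (\<lambda>x. k x - g x)"
  using L2_norm_add[OF L2_diff[OF assms(1,3)] L2_diff[OF assms(3,2)]] by simp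

lemma L2_norm_mono:
  assumes "f \<in> L2" "g \<in> L2" "\<And>x. \<bar>g x\<bar> \<le> \<bar>f x\<bar>"
  shows "L2_norm g \<le> L2_norm f"
  unfolding L2_norm_def using assms
  by (intro real_sqrt_le_mono integral_mono L2_square_integrable) (auto simp: abs_le_square_iff)

lemma L2_norm_mult_bounded:
  assumes "f \<in> L2" "g \<in> borel_measurable borel" "\<And>x. \<bar>g x\<bar> \<le> B"
  shows "L2_norm (\<lambda>x. g x * f x) \<le> B * L2_norm f"
proof -
  have "B \<ge> 0" using assms(3)[of 0] by simp
  have "L2_norm (\<lambda>x. g x * f x) \<le> L2_norm (\<lambda>x. B * f x)"
  proof (rule L2_norm_mono[OF L2_cmult[OF assms(1)] L2_mult_bounded[OF assms]])
    show "\<bar>g x * f x\<bar> \<le> \<bar>B * f x\<bar>" for x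
      unfolding abs_mult abs_of_nonneg[OF \<open>B \<ge> 0\<close>] by (rule mult_right_mono[OF assms(3)]) simp
  qed
  then show ?thesis using \<open>B \<ge> 0\<close> by (simp add: L2_norm_cmult)
qed

abbreviation L2_lim :: "('a \<Rightarrow> real \<Rightarrow> real) \<Rightarrow> (real \<Rightarrow> real) \<Rightarrow> 'a filter \<Rightarrow> bool" where
  "L2_lim fs f F \<equiv> ((\<lambda>s. L2_norm (\<lambda>x. fs s x - f x)) \<longlongrightarrow> 0) F"

lemma L2_lim_inner:
  assumes "\<forall>\<^sub>F s in F. fs s \<in> L2" "\<forall>\<^sub>F s in F. gs s \<in> L2" "f \<in> L2" "g \<in> L2"
    and "L2_lim fs f F" "L2_lim gs g F"
  shows "((\<lambda>s. \<integral>x. fs s x * gs s x \<partial>lborel) \<longlongrightarrow> (\<integral>x. f x * g x \<partial>lborel)) F"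
proof -
  let ?A = "\<lambda>s. L2_norm (\<lambda>x. fs s x - f x)" and ?B = "\<lambda>s. L2_norm (\<lambda>x. gs s x - g x)"
  have "((\<lambda>s. (\<integral>x. fs s x * gs s x \<partial>lborel) - (\<integral>x. f x * g x \<partial>lborel)) \<longlongrightarrow> 0) F"
  proof (rule Lim_null_comparison)
    show "((\<lambda>s. ?A s * ?B s + ?A s * L2_norm g + L2_norm f * ?B s) \<longlongrightarrow> 0) F"
      using assms(5,6) by (auto intro!: tendsto_eq_intros)
    show "\<forall>\<^sub>F s in F. norm ((\<integral>x. fs s x * gs s x \<partial>lborel) - (\<integral>x. f x * g x \<partial>lborel))
       \<le> ?A s * ?B s + ?A s * L2_norm g + L2_norm f * ?B s"
      using assms(1,2)
    proof eventually_elim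
      case (elim s)
      have d: "(\<lambda>x. fs s x - f x) \<in> L2" "(\<lambda>x. gs s x - g x) \<in> L2" using elim assms(3,4) by (auto intro: L2_diff)
      note int = L2_mult_integrable[OF d] L2_mult_integrable[OF d(1) assms(4)] L2_mult_integrable[OF assms(3) d(2)]
        L2_mult_integrable[OF elim] L2_mult_integrable[OF assms(3,4)]
      have "(\<integral>x. fs s x * gs s x \<partial>lborel) - (\<integral>x. f x * g x \<partial>lborel) =
        (\<integral>x. fs s x * gs s x - f x * g x \<partial>lborel)"
        using int by simp
      also have "\<dots> = (\<integral>x. (fs s x - f x) * (gs s x - g x) + (fs s x - f x) * g x + f x * (gs s x - g x) \<partial>lborel)"
        by (intro Bochner_Integration.integral_cong) (auto simp: algebra_simps)
      also have "\<dots> = (\<integral>x. (fs s x - f x) * (gs s x - g x) \<partial>lborel) + (\<integral>x. (fs s x - f x) * g x \<partial>lborel)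
          + (\<integral>x. f x * (gs s x - g x) \<partial>lborel)"
        using int(1-3) by simp
      finally show ?case
        using L2_Cauchy_Schwarz[OF d] L2_Cauchy_Schwarz[OF d(1) assms(4)] L2_Cauchy_Schwarz[OF assms(3) d(2)]
        by simp
    qed
  qed
  then show ?thesis by (simp add: LIM_zero_iff)
qed

lemma L2_lim_unique:
  assumes "\<forall>\<^sub>F s in F. fs s \<in> L2" "f \<in> L2" "g \<in> L2" "L2_lim fs f F" "L2_lim fs g F" "F \<noteq> bot"
  shows "AE x in lborel. f x = g x"
proof -
  have "\<forall>\<^sub>F s in F. L2_norm (\<lambda>x. f x - g x) \<le> L2_norm (\<lambda>x. fs s x - f x) + L2_norm (\<lambda>x. fs s x - g x)"
    using assms(1)
  proof eventually_elim
    case (elim s)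
    show ?case using L2_norm_triangle[OF assms(2,3) elim] L2_norm_minus_commute[of f "fs s"] by simp
  qed
  moreover have "((\<lambda>s. L2_norm (\<lambda>x. fs s x - f x) + L2_norm (\<lambda>x. fs s x - g x)) \<longlongrightarrow> 0) F"
    using assms(4,5) by (auto intro!: tendsto_eq_intros)
  ultimately have "L2_norm (\<lambda>x. f x - g x) \<le> 0"
    using assms(6) by (intro tendsto_lowerbound[where F=F])
  then have "(\<integral>x. (f x - g x)\<^sup>2 \<partial>lborel) = 0"
    using L2_norm_square[of "\<lambda>x. f x - g x"] L2_norm_nonneg[of "\<lambda>x. f x - g x"] by simp
  then have "AE x in lborel. (f x - g x)\<^sup>2 = 0"
    using L2_square_integrable[OF L2_diff[OF assms(2,3)]] by (subst (asm) integral_nonneg_eq_0_iff_AE) auto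
  then show ?thesis by simp
qed

text \<open>
  Restricting to a set does not increase the norm, so a limit inherits the zeros of its
  approximants. This transfers the local vanishing of \<open>u\<close> to its derivatives in \<open>t\<close> and \<open>x\<close>.
\<close>
lemma L2_lim_zero_on:
  assumes "\<forall>\<^sub>F s in F. fs s \<in> L2" "f \<in> L2" "L2_lim fs f F" "F \<noteq> bot"
    and "\<forall>\<^sub>F s in F. \<forall>x\<in>A. fs s x = 0" and [measurable]: "A \<in> sets borel"
  shows "AE x in lborel. x \<in> A \<longrightarrow> f x = 0"
proof -
  let ?r = "\<lambda>f x. indicator A x * f x :: real"
  have L2r: "?r f \<in> L2" if "f \<in> L2" for f
    using that by (rule L2_mult_bounded[where B=1]) (auto simp: indicator_def)
  have lim: "L2_lim (\<lambda>s. ?r (fs s)) (?r f) F"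
  proof (rule Lim_null_comparison[OF _ assms(3)])
    show "\<forall>\<^sub>F s in F. norm (L2_norm (\<lambda>x. ?r (fs s) x - ?r f x)) \<le> L2_norm (\<lambda>x. fs s x - f x)"
      using assms(1)
    proof eventually_elim
      case (elim s)
      have "L2_norm (?r (\<lambda>x. fs s x - f x)) \<le> 1 * L2_norm (\<lambda>x. fs s x - f x)"
        using elim assms(2) by (intro L2_norm_mult_bounded L2_diff) (auto simp: indicator_def)
      then show ?case by (simp add: right_diff_distrib)
    qed
  qed
  have lim0: "L2_lim (\<lambda>s. ?r (fs s)) (\<lambda>x. 0) F"
  proof (rule tendsto_eventually)
    show "\<forall>\<^sub>F s in F. L2_norm (\<lambda>x. ?r (fs s) x - 0) = 0"
      using assms(5)
    proof eventually_elim
      case (elim s)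
      then have "(\<lambda>x. ?r (fs s) x - 0) = (\<lambda>x. 0)" by (auto simp: indicator_def)
      then show ?case by (simp add: L2_norm_def)
    qed
  qed
  have "AE x in lborel. ?r f x = 0"
  proof (rule L2_lim_unique[OF _ L2r[OF assms(2)] _ lim lim0 assms(4)])
    show "\<forall>\<^sub>F s in F. ?r (fs s) \<in> L2"
      using assms(1) by (rule eventually_mono) (rule L2r)
    show "(\<lambda>x. 0) \<in> L2" by (simp add: L2_def)
  qed
  then show ?thesis by (auto simp: indicator_def elim: eventually_mono)
qed

text \<open>
  Both averages over a window and convolutions take the form \<open>\<integral>K r * f (x + r)\<close> after a
  substitution; Fubini's theorem then gives the \<open>L\<^sup>1\<close> bounds for both.
\<close>
lemma correlation:
  fixes K f :: "real \<Rightarrow> real"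
  assumes K: "integrable lborel K" and f: "integrable lborel f"
  shows "integrable lborel (\<lambda>x. \<integral>r. K r * f (x + r) \<partial>lborel)" (is ?i)
    and "(\<integral>x. (\<integral>r. K r * f (x + r) \<partial>lborel) \<partial>lborel) = (\<integral>r. K r \<partial>lborel) * (\<integral>x. f x \<partial>lborel)" (is ?e)
proof -
  have [measurable]: "K \<in> borel_measurable borel" "f \<in> borel_measurable borel" using K f by auto
  have "integrable (lborel \<Otimes>\<^sub>M lborel) (\<lambda>p. K (fst p) * f (snd p + fst p))"
  proof (rule lborel_pair.Fubini_integrable)
    show "(\<lambda>p. K (fst p) * f (snd p + fst p)) \<in> borel_measurable (lborel \<Otimes>\<^sub>M lborel)" by simp
    have "(\<lambda>r. \<integral>x. norm (K (fst (r, x)) * f (snd (r, x) + fst (r, x))) \<partial>lborel) = (\<lambda>r. \<bar>K r\<bar> * (\<integral>x. \<bar>f x\<bar> \<partial>lborel))"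
      by (simp add: abs_mult integral_shift[where f = "\<lambda>x. \<bar>f x\<bar>"])
    then show "integrable lborel (\<lambda>r. \<integral>x. norm (K (fst (r, x)) * f (snd (r, x) + fst (r, x))) \<partial>lborel)"
      using K by simp
    show "AE r in lborel. integrable lborel (\<lambda>x. K (fst (r, x)) * f (snd (r, x) + fst (r, x)))"
      using integrable_shift[OF f] by simp
  qed
  then have I: "integrable (lborel \<Otimes>\<^sub>M lborel) (\<lambda>(r, x). K r * f (x + r))" by (simp add: case_prod_beta')
  from lborel_pair.integrable_snd[OF this] show ?i by simp
  from lborel_pair.Fubini_integral[OF I] show ?e
    by (simp add: integral_shift)
qed

lemma correlation_abs:
  fixes K f :: "real \<Rightarrow> real"
  assumes K: "integrable lborel K" and f: "integrable lborel f"
  shows "(\<integral>x. \<bar>\<integral>r. K r * f (x + r) \<partial>lborel\<bar> \<partial>lborel) \<le> (\<integral>r. \<bar>K r\<bar> \<partial>lborel) * (\<integral>x. \<bar>f x\<bar> \<partial>lborel)"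
proof -
  have "(\<integral>x. \<bar>\<integral>r. K r * f (x + r) \<partial>lborel\<bar> \<partial>lborel) \<le> (\<integral>x. (\<integral>r. \<bar>K r\<bar> * \<bar>f (x + r)\<bar> \<partial>lborel) \<partial>lborel)"
  proof (rule integral_mono)
    show "integrable lborel (\<lambda>x. \<bar>\<integral>r. K r * f (x + r) \<partial>lborel\<bar>)" using correlation(1)[OF K f] by simp
    show "integrable lborel (\<lambda>x. \<integral>r. \<bar>K r\<bar> * \<bar>f (x + r)\<bar> \<partial>lborel)" 
      using correlation(1)[of "\<lambda>r. \<bar>K r\<bar>" "\<lambda>x. \<bar>f x\<bar>"] K f by simp
    show "\<bar>\<integral>r. K r * f (x + r) \<partial>lborel\<bar> \<le> (\<integral>r. \<bar>K r\<bar> * \<bar>f (x + r)\<bar> \<partial>lborel)" for x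
      using integral_abs_bound[of lborel "\<lambda>r. K r * f (x + r)"] by (simp add: abs_mult)
  qed
  also have "\<dots> = (\<integral>r. \<bar>K r\<bar> \<partial>lborel) * (\<integral>x. \<bar>f x\<bar> \<partial>lborel)"
    using correlation(2)[of "\<lambda>r. \<bar>K r\<bar>" "\<lambda>x. \<bar>f x\<bar>"] K f by simp
  finally show ?thesis .
qed

section \<open>Smooth steps and the fundamental theorem for weak derivatives\<close>

text \<open>
  Coinduction for smoothness: a class of functions that is closed under differentiation consists
  of smooth functions.
\<close>
lemma smooth_coinduct:
  assumes closed: "\<And>f. f \<in> S \<Longrightarrow> \<exists>g\<in>S. \<forall>x. (f has_field_derivative g x) (at x)"
    and "f \<in> S"
  shows "(deriv ^^ n) f field_differentiable at x"
proof -
  have "(deriv ^^ n) f \<in> S" for n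
  proof (induction n)
    case (Suc n)
    from closed[OF Suc] obtain g where g: "g \<in> S" "\<forall>x. ((deriv ^^ n) f has_field_derivative g x) (at x)" by blast
    then have "deriv ((deriv ^^ n) f) = g" by (auto intro: DERIV_imp_deriv)
    with g show ?case by simp
  qed (simp add: assms)
  with closed show ?thesis unfolding field_differentiable_def by blast
qed

text \<open>
  The derivative of \<open>exp (- 1 / (x (1 - x)))\<close> is that function times a rational one whose
  denominator is a power of \<open>x (1 - x)\<close>. Polynomials \<open>q\<close> over such powers make the family closed
  under differentiation.
\<close>
definition bump :: "nat \<Rightarrow> real poly \<Rightarrow> real \<Rightarrow> real" where
  "bump k q x = (if 0 < x \<and> x < 1 then poly q x * exp (- (1 / (x * (1 - x)))) / (x * (1 - x)) ^ k else 0)"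

lemma exp_decay: assumes "s > 0" shows "exp (- (1 / s)) / s ^ k \<le> fact (k + 2) * (s::real)\<^sup>2"
proof -
  have "(1 / s) ^ (k + 2) / fact (k + 2) \<le> exp (1 / s)"
  proof -
    have "(\<Sum>n\<in>{k + 2}. (1 / s) ^ n /\<^sub>R fact n) \<le> exp (1 / s)"
      unfolding exp_def using assms by (intro sum_le_suminf summable_exp_generic) auto
    then show ?thesis by (simp add: divide_inverse mult.commute)
  qed
  then have "1 \<le> fact (k + 2) * s ^ (k + 2) * exp (1 / s)"
    using assms by (simp add: power_divide divide_simps mult_ac)
  then have "exp (- (1 / s)) \<le> fact (k + 2) * s ^ (k + 2)"
    using assms by (simp add: exp_minus divide_simps)
  then show ?thesis using assms by (simp add: divide_simps power_add mult_ac power2_eq_square)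
qed

text \<open>
  At the two ends of \<open>[0, 1]\<close> the exponential beats every power of \<open>x (1 - x)\<close>. Quadratic decay
  there is what makes the derivative at the ends exist and be zero.
\<close>
lemma bump_quadratic: "\<exists>C. \<forall>a\<in>{0, 1}. \<forall>y. \<bar>bump k q y\<bar> \<le> C * (y - a)\<^sup>2"
proof -
  have "bounded (poly q ` {0..1})"
    by (intro compact_imp_bounded compact_continuous_image) (auto intro!: continuous_intros)
  then obtain Q where Q: "\<And>y. y \<in> {0..1} \<Longrightarrow> \<bar>poly q y\<bar> \<le> Q" "Q > 0"
    unfolding bounded_pos by fastforce
  have "\<bar>bump k q y\<bar> \<le> (Q * fact (k + 2)) * (y - a)\<^sup>2" if a: "a \<in> {0, 1}" for a y :: real
  proof (cases "0 < y \<and> y < 1")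
    case True
    define s where "s = y * (1 - y)"
    have s: "s > 0" "s \<le> \<bar>y - a\<bar>" using True a by (auto simp: s_def mult_le_cancel_left1 mult_le_cancel_right1)
    have "\<bar>bump k q y\<bar> = \<bar>poly q y\<bar> * (exp (- (1 / s)) / s ^ k)"
      using True s by (simp add: bump_def s_def[symmetric] abs_mult)
    also have "\<dots> \<le> Q * (fact (k + 2) * s\<^sup>2)"
      using Q True s by (intro mult_mono exp_decay) auto
    also have "\<dots> \<le> Q * (fact (k + 2) * (y - a)\<^sup>2)"
      using Q s by (intro mult_left_mono) (auto simp: abs_le_square_iff[symmetric])
    finally show ?thesis by (simp add: mult_ac)
  qed (use Q in \<open>auto simp: bump_def\<close>)
  then show ?thesis by blast
qed

lemma bump_deriv: "\<exists>k' q'. \<forall>x. (bump k q has_field_derivative bump k' q' x) (at x)"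
proof -
  define q' where "q' = pderiv q * [:0, 1, -1:]\<^sup>2 + q * [:1, -2:] - smult (of_nat k) (q * [:1, -2:] * [:0, 1, -1:])"
  have "(bump k q has_field_derivative bump (k + 2) q' x) (at x)" for x
  proof -
    consider "0 < x" "x < 1" | "x = 0 \<or> x = 1" | "x < 0 \<or> x > 1" by linarith
    then show ?thesis
    proof cases
      case 1
      define s where "s = x * (1 - x)"
      have "s > 0" using 1 by (simp add: s_def)
      define i where "i x = inverse (x * (1 - x))" for x :: real
      have inv: "i x * s = 1" using 1 unfolding i_def s_def by (intro left_inverse) simp
      have di: "(i has_field_derivative - ((i x)\<^sup>2 * (1 - 2 * x))) (at x)"
        unfolding i_def using 1 by (auto intro!: derivative_eq_intros simp: divide_simps power2_eq_square)
      have low: "real k * i x ^ (k - 1) * (i x)\<^sup>2 = real k * i x ^ (k + 1)"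
        by (cases k) (auto simp: power2_eq_square)
      have up: "i x ^ k = s\<^sup>2 * i x ^ (k + 2)" "i x ^ (k + 1) = s * i x ^ (k + 2)"
      proof -
        have "s\<^sup>2 * i x ^ (k + 2) = (i x * s)\<^sup>2 * i x ^ k" "s * i x ^ (k + 2) = (i x * s) * i x ^ (k + 1)"
          by (simp_all add: power_add power2_eq_square mult_ac)
        then show "i x ^ k = s\<^sup>2 * i x ^ (k + 2)" "i x ^ (k + 1) = s * i x ^ (k + 2)"
          unfolding inv by simp_all
      qed
      have "((\<lambda>x. poly q x * exp (- i x) * i x ^ k) has_field_derivative
         (poly (pderiv q) x * exp (- i x) + exp (- i x) * ((i x)\<^sup>2 * (1 - 2 * x)) * poly q x) * i x ^ k
          - real k * i x ^ (k - 1) * (i x)\<^sup>2 * (1 - 2 * x) * (poly q x * exp (- i x))) (at x)"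
        by (rule derivative_eq_intros poly_DERIV di refl)+ (simp add: algebra_simps)
      also have "(poly (pderiv q) x * exp (- i x) + exp (- i x) * ((i x)\<^sup>2 * (1 - 2 * x)) * poly q x) * i x ^ k
          - real k * i x ^ (k - 1) * (i x)\<^sup>2 * (1 - 2 * x) * (poly q x * exp (- i x))
        = exp (- i x) * (poly (pderiv q) x * i x ^ k + poly q x * (1 - 2 * x) * i x ^ (k + 2)
          - real k * poly q x * (1 - 2 * x) * i x ^ (k + 1))"
        unfolding low by (simp add: algebra_simps power2_eq_square)
      also have "\<dots> = poly q' x * exp (- i x) * i x ^ (k + 2)"
        unfolding up by (simp add: q'_def s_def algebra_simps power2_eq_square)
      also have "\<dots> = bump (k + 2) q' x"
        using 1 by (simp only: bump_def i_def divide_inverse power_inverse mult_1_left simp_thms if_True)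
      finally have "((\<lambda>x. poly q x * exp (- i x) * i x ^ k) has_field_derivative bump (k + 2) q' x) (at x)" .
      then show ?thesis
        by (rule has_field_derivative_transform_within_open[where S="{0<..<1}"])
          (use 1 in \<open>simp_all add: bump_def i_def divide_inverse power_inverse del: inverse_mult_distrib\<close>)
    next
      case 2
      then have 0: "bump k q x = 0" "bump (k + 2) q' x = 0" by (auto simp: bump_def)
      from bump_quadratic[of k q] 2 obtain C where C: "\<And>y. \<bar>bump k q y\<bar> \<le> C * (y - x)\<^sup>2" by blast
      have "((\<lambda>y. (bump k q y - bump k q x) / (y - x)) \<longlongrightarrow> 0) (at x)"
      proof (rule Lim_null_comparison)
        show "\<forall>\<^sub>F y in at x. norm ((bump k q y - bump k q x) / (y - x)) \<le> C * \<bar>y - x\<bar>"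
        proof (rule eventually_mono[OF eventually_neq_at_within[of x]])
          fix y assume "y \<noteq> x"
          then show "norm ((bump k q y - bump k q x) / (y - x)) \<le> C * \<bar>y - x\<bar>"
            using C[of y] 0 by (simp add: divide_simps power2_eq_square abs_mult mult.assoc flip: abs_mult)
        qed
        have "((\<lambda>y. C * \<bar>y - x\<bar>) \<longlongrightarrow> C * \<bar>x - x\<bar>) (at x)" by (intro tendsto_intros)
        then show "((\<lambda>y. C * \<bar>y - x\<bar>) \<longlongrightarrow> 0) (at x)" by simp
      qed
      then show ?thesis by (simp only: has_field_derivative_iff 0(2))
    next
      case 3
      have "((\<lambda>x. 0) has_field_derivative bump (k + 2) q' x) (at x)" using 3 by (auto simp: bump_def)
      then show ?thesis
        by (rule has_field_derivative_transform_within_open[where S="{..<0} \<union> {1<..}"])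
          (use 3 in \<open>auto simp: bump_def\<close>)
    qed
  qed
  then show ?thesis by blast
qed

text \<open>
  The step \<open>B\<close> is the normalised antiderivative of a bump. The class \<open>S\<close> witnesses that \<open>B\<close> is
  smooth, in a form that also covers rescaled and translated copies of \<open>B\<close>.
\<close>
lemma smooth_step:
  obtains B :: "real \<Rightarrow> real" and S b where
    "B \<in> S" "\<And>f. f \<in> S \<Longrightarrow> \<exists>g\<in>S. \<forall>x. (f has_field_derivative g x) (at x)"
    "\<And>x. (B has_field_derivative b x) (at x)" "continuous_on UNIV b"
    "\<And>x. x \<le> 0 \<Longrightarrow> B x = 0" "\<And>x. x \<ge> 1 \<Longrightarrow> B x = 1" "\<And>x. 0 \<le> B x" "\<And>x. B x \<le> 1"
    "\<And>x. 0 \<le> b x" "\<And>x. x \<notin> {0..1} \<Longrightarrow> b x = 0"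
proof -
  let ?e = "bump 0 1"
  have cont: "isCont ?e x" for x using bump_deriv[of 0 1] DERIV_isCont by blast
  from einterval_antiderivative[of "-\<infinity>" "\<infinity>" ?e] cont
  obtain F where F: "\<And>x. (F has_field_derivative ?e x) (at x)"
    by (auto simp: has_real_derivative_iff_has_vector_derivative)
  have e: "?e x \<ge> 0" "x \<notin> {0<..<1} \<Longrightarrow> ?e x = 0" "x \<in> {0<..<1} \<Longrightarrow> ?e x > 0" for x
    by (auto simp: bump_def)
  have mono: "F x \<le> F y" if "x \<le> y" for x y
    by (rule DERIV_nonneg_imp_nondecreasing[OF that]) (use F e(1) in blast)
  have left: "F x = F 0" if "x \<le> 0" for x
  proof (cases "x < 0")
    case True
    from MVT2[OF this, of F ?e] F obtain z where "z < 0" "F 0 - F x = (0 - x) * ?e z" by blast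
    then show ?thesis using e(2)[of z] by simp
  qed (use that in simp)
  have right: "F x = F 1" if "x \<ge> 1" for x
  proof (cases "x > 1")
    case True
    from MVT2[OF this, of F ?e] F obtain z where "z > 1" "F x - F 1 = (x - 1) * ?e z" by blast
    then show ?thesis using e(2)[of z] by simp
  qed (use that in simp)
  have pos: "F 0 < F 1"
  proof -
    from MVT2[OF zero_less_one, of F ?e] F obtain z where "z > 0" "z < 1" "F 1 - F 0 = (1 - 0) * ?e z" by blast
    then show ?thesis using e(3)[of z] by simp
  qed
  define c where "c = 1 / (F 1 - F 0)"
  have c: "c > 0" using pos by (simp add: c_def)
  define B where "B x = c * (F x - F 0)" for x
  have dB: "(B has_field_derivative c * ?e x) (at x)" for x
    unfolding B_def by (auto intro!: derivative_eq_intros F)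
  define S where "S = insert B (range (\<lambda>(k, q) x. c * bump k q x))"
  show thesis
  proof (rule that[of B S "\<lambda>x. c * ?e x"])
    show "B \<in> S" by (simp add: S_def)
    fix f assume "f \<in> S"
    then consider "f = B" | k q where "f = (\<lambda>x. c * bump k q x)" by (auto simp: S_def)
    then show "\<exists>g\<in>S. \<forall>x. (f has_field_derivative g x) (at x)"
    proof cases
      case 1
      have "(\<lambda>x. c * ?e x) \<in> S" unfolding S_def by force
      then show ?thesis using dB unfolding 1 by (intro bexI[of _ "\<lambda>x. c * ?e x"] allI)
    next
      case 2
      from bump_deriv[of k q] obtain k' q' where d: "\<forall>x. (bump k q has_field_derivative bump k' q' x) (at x)" by blast
      have "(\<lambda>x. c * bump k' q' x) \<in> S" unfolding S_def by force
      moreover have "\<forall>x. (f has_field_derivative c * bump k' q' x) (at x)"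
        unfolding 2 using d by (auto intro!: DERIV_cmult)
      ultimately show ?thesis by (intro bexI[of _ "\<lambda>x. c * bump k' q' x"])
    qed
  next
    show "continuous_on UNIV (\<lambda>x. c * ?e x)"
      using cont by (intro continuous_on_mult_left) (auto simp: continuous_on_eq_continuous_at)
    show "B x = 0" if "x \<le> 0" for x using left[OF that] by (simp add: B_def)
    show "B x = 1" if "x \<ge> 1" for x using right[OF that] pos by (simp add: B_def c_def)
    show "0 \<le> B x" for x
      using mono[of 0 x] left[of x] c by (cases "x \<le> 0") (auto simp: B_def)
    show "B x \<le> 1" for x
      using mono[of x 1] right[of x] c pos by (cases "x \<ge> 1") (auto simp: B_def c_def)
    show "0 \<le> c * ?e x" for x using c e by simp
    show "c * ?e x = 0" if "x \<notin> {0..1}" for x using e(2)[of x] that by auto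
  qed (rule dB)
qed

text \<open>
  A steep smooth step up at \<open>x\<close> followed by one down at \<open>y\<close> is a test function \<open>\<phi>\<close> that tends to the
  indicator of \<open>[x, y]\<close>, while \<open>\<phi>'\<close> tends to the difference of the point masses at \<open>x\<close> and \<open>y\<close>.
  Continuity of \<open>f\<close> is needed for the latter limit.
\<close>
lemma weak_derivative_FTC:
  assumes f: "f \<in> L2" "continuous_on UNIV f" and w: "has_weak_L2_deriv f w" and xy: "x \<le> y"
  shows "f y - f x = (\<integral>z. indicator {x..y} z * w z \<partial>lborel)"
proof -
  obtain B S and b :: "real \<Rightarrow> real" where S: "(B :: real \<Rightarrow> real) \<in> S" "\<And>f. f \<in> S \<Longrightarrow> \<exists>g\<in>S. \<forall>x. (f has_field_derivative g x) (at x)"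
    and dB: "\<And>x. (B has_field_derivative b x) (at x)" and cb: "continuous_on UNIV b"
    and B: "\<And>x. x \<le> 0 \<Longrightarrow> B x = 0" "\<And>x. x \<ge> 1 \<Longrightarrow> B x = 1" "\<And>x. 0 \<le> B x" "\<And>x. B x \<le> 1"
    and b: "\<And>x. 0 \<le> b x" "\<And>x. x \<notin> {0..1} \<Longrightarrow> b x = 0"
    by (rule smooth_step) metis
  have wL2: "w \<in> L2" using w by (simp add: has_weak_L2_deriv_def)
  have [measurable]: "f \<in> borel_measurable borel" "w \<in> borel_measurable borel" "b \<in> borel_measurable borel"
    using f wL2 cb by (auto intro: borel_measurable_continuous_onI simp: L2_measurable)
  have cB: "continuous_on UNIV B"
    using DERIV_isCont[OF dB] by (simp add: continuous_on_eq_continuous_at)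
  then have [measurable]: "B \<in> borel_measurable borel" by (rule borel_measurable_continuous_onI)
  \<comment> \<open>the steepness of the step\<close>
  define N where "N n = real (Suc n)" for n
  have N: "N n \<ge> 1" for n by (simp add: N_def)
  define \<phi> where "\<phi> n z = B (N n * (z - x)) - B (N n * (z - y))" for n z
  define \<phi>' where "\<phi>' n z = N n * b (N n * (z - x)) - N n * b (N n * (z - y))" for n z
  have d\<phi>: "deriv (\<phi> n) = \<phi>' n" for n
  proof (rule ext, rule DERIV_imp_deriv)
    have *: "((\<lambda>z. B (N n * (z - a))) has_field_derivative b (N n * (z - a)) * N n) (at z)" for z a
      by (rule DERIV_chain2[OF dB]) (auto intro!: derivative_eq_intros)
    show "(\<phi> n has_field_derivative \<phi>' n z) (at z)" for z
      unfolding \<phi>_def \<phi>'_def using DERIV_diff[OF *[of x z] *[of y z]] by (simp add: mult.commute)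
  qed
  have test: "test_function (\<phi> n)" for n
    unfolding test_function_def
  proof (intro conjI allI)
    \<comment> \<open>The factor \<open>p\<close> collects the powers of the steepness that differentiation produces.\<close>
    define S' where "S' = {(\<lambda>z. p * H (N n * (z - x)) - p * H (N n * (z - y))) |p H. H \<in> S}"
    show "(deriv ^^ m) (\<phi> n) field_differentiable at z" for m z
    proof (rule smooth_coinduct[of S'])
      show "\<phi> n \<in> S'" unfolding S'_def \<phi>_def using S(1) by (intro CollectI exI[of _ 1] exI[of _ B]) auto
      fix g assume "g \<in> S'"
      then obtain p H where g: "g = (\<lambda>z. p * H (N n * (z - x)) - p * H (N n * (z - y)))" "H \<in> S"
        by (auto simp: S'_def)
      from S(2)[OF g(2)] obtain G where G: "G \<in> S" "\<forall>x. (H has_field_derivative G x) (at x)" by blast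
      have *: "((\<lambda>z. p * H (N n * (z - a))) has_field_derivative p * (G (N n * (z - a)) * N n)) (at z)" for z a
        by (rule DERIV_cmult[OF DERIV_chain2[where g="\<lambda>z. N n * (z - a)", OF G(2)[rule_format]]]) (auto intro!: derivative_eq_intros)
      have "(\<lambda>z. (p * N n) * G (N n * (z - x)) - (p * N n) * G (N n * (z - y))) \<in> S'"
        unfolding S'_def using G by blast
      moreover have "\<forall>z. (g has_field_derivative (p * N n) * G (N n * (z - x)) - (p * N n) * G (N n * (z - y))) (at z)"
        unfolding g using DERIV_diff[OF *[of x] *[of y]] by (simp add: mult_ac)
      ultimately show "\<exists>h\<in>S'. \<forall>x. (g has_field_derivative h x) (at x)"
        by (intro bexI[of _ "\<lambda>z. p * N n * G (N n * (z - x)) - p * N n * G (N n * (z - y))"])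
    qed
    show "\<exists>R. \<forall>z. R < \<bar>z\<bar> \<longrightarrow> \<phi> n z = 0"
    proof (intro exI[of _ "\<bar>x\<bar> + \<bar>y\<bar> + 1"] allI impI)
      fix z assume z: "\<bar>x\<bar> + \<bar>y\<bar> + 1 < \<bar>z\<bar>"
      show "\<phi> n z = 0"
      proof (cases "z < 0")
        case True
        then have "N n * (z - x) \<le> 0" "N n * (z - y) \<le> 0" using z N[of n] by (auto simp: mult_le_0_iff)
        then show ?thesis by (simp add: \<phi>_def B)
      next
        case False
        then have "1 * 1 \<le> N n * (z - x)" "1 * 1 \<le> N n * (z - y)"
          using z N[of n] by (intro mult_mono; simp)+
        then show ?thesis by (simp add: \<phi>_def B)
      qed
    qed
  qed
  have eq: "(\<integral>z. f z * \<phi>' n z \<partial>lborel) = - (\<integral>z. w z * \<phi> n z \<partial>lborel)" for n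
    using w test[of n] unfolding has_weak_L2_deriv_def d\<phi>[symmetric] by blast
  have lim1: "(\<lambda>n. \<integral>z. w z * \<phi> n z \<partial>lborel) \<longlonglongrightarrow> (\<integral>z. indicator {x..y} z * w z \<partial>lborel)"
  proof (rule integral_dominated_convergence)
    have "(indicator {x..y + 1} :: real \<Rightarrow> real) \<in> L2"
      by (rule L2_indicator)
    moreover have "(\<lambda>z. \<bar>w z\<bar>) \<in> L2" using wL2 by (simp add: L2_def)
    ultimately show "integrable lborel (\<lambda>z. indicator {x..y + 1} z * \<bar>w z\<bar>)" by (rule L2_mult_integrable)
    show "(\<lambda>z. w z * \<phi> n z) \<in> borel_measurable lborel" for n unfolding \<phi>_def by measurable
    show "AE z in lborel. norm (w z * \<phi> n z) \<le> indicator {x..y + 1} z * \<bar>w z\<bar>" for n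
    proof (rule AE_I2)
      fix z
      show "norm (w z * \<phi> n z) \<le> indicator {x..y + 1} z * \<bar>w z\<bar>"
      proof (cases "z \<in> {x..y + 1}")
        case True
        have "\<bar>\<phi> n z\<bar> \<le> 1" using B(3,4)[of "N n * (z - x)"] B(3,4)[of "N n * (z - y)"] by (simp add: \<phi>_def)
        then show ?thesis using True mult_left_mono[of "\<bar>\<phi> n z\<bar>" 1 "\<bar>w z\<bar>"] by (simp add: abs_mult)
      next
        case False
        have "\<phi> n z = 0"
        proof (cases "z < x")
          case True
          then have "N n * (z - x) \<le> 0" "N n * (z - y) \<le> 0" using N[of n] xy by (auto simp: mult_le_0_iff)
          then show ?thesis by (simp add: \<phi>_def B)
        next
          case F: False
          then have "1 * 1 \<le> N n * (z - x)" "1 * 1 \<le> N n * (z - y)"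
            using False xy N[of n] by (intro mult_mono; simp)+
          then show ?thesis by (simp add: \<phi>_def B)
        qed
        then show ?thesis by simp
      qed
    qed
    \<comment> \<open>Off the two jumps the test functions are eventually constant in \<open>n\<close>.\<close>
    have large: "\<forall>\<^sub>F n in sequentially. B (N n * (z - a)) = 1" if "z > a" for z a
    proof -
      have "filterlim (\<lambda>n. N n * (z - a)) at_top sequentially"
        unfolding N_def using that
        by (intro filterlim_tendsto_pos_mult_at_top[OF tendsto_const _] filterlim_at_top_mult_tendsto_pos[OF tendsto_const]
            filterlim_compose[OF filterlim_real_sequentially filterlim_Suc]) auto
      then have "\<forall>\<^sub>F n in sequentially. N n * (z - a) \<ge> 1" by (simp add: filterlim_at_top)
      then show ?thesis by (rule eventually_mono) (rule B)
    qed
    have small: "B (N n * (z - a)) = 0" if "z < a" for z a n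
      using that N[of n] by (intro B) (simp add: mult_le_0_iff)
    have "AE z in lborel. z \<noteq> x" "AE z in lborel. z \<noteq> y" by (rule AE_lborel_singleton)+
    then show "AE z in lborel. (\<lambda>n. w z * \<phi> n z) \<longlonglongrightarrow> indicator {x..y} z * w z"
    proof eventually_elim
      case (elim z)
      have "\<forall>\<^sub>F n in sequentially. w z * \<phi> n z = indicator {x..y} z * w z"
      proof -
        consider "z < x" | "x < z" "z < y" | "y < z" using elim by linarith
        then show ?thesis
        proof cases
          case 1 then show ?thesis using small[of z x] small[of z y] xy by (simp add: \<phi>_def)
        next
          case 2
          show ?thesis using large[OF 2(1)] by eventually_elim (use 2 small[of z y] in \<open>simp add: \<phi>_def\<close>)
        next
          case 3
          then have "x < z" using xy by simp
          show ?thesis using large[OF 3] large[OF \<open>x < z\<close>] by eventually_elim (use 3 in \<open>simp add: \<phi>_def\<close>)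
        qed
      qed
      then show ?case by (rule tendsto_eventually)
    qed
  qed simp
  have int_b: "has_bochner_integral lborel b 1"
  proof -
    have "has_bochner_integral lborel (\<lambda>x. b x * indicator {0..1} x) (B 1 - B 0)"
      by (rule has_bochner_integral_FTC_Icc_nonneg) (auto intro: dB DERIV_subset b continuous_on_subset[OF cb])
    moreover have "(\<lambda>x. b x * indicator {0..1} x) = b" using b(2) by (fastforce simp: indicator_def)
    ultimately show ?thesis by (simp add: B)
  qed
  have part: "integrable lborel (\<lambda>z. f z * (N n * b (N n * (z - a))))"
    "(\<lambda>n. \<integral>z. f z * (N n * b (N n * (z - a))) \<partial>lborel) \<longlonglongrightarrow> f a" for a n
  proof -
    have "bounded (f ` {a..a + 1})"
      by (intro compact_imp_bounded compact_continuous_image continuous_on_subset[OF f(2)]) auto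
    then obtain C where C: "\<And>z. z \<in> {a..a + 1} \<Longrightarrow> \<bar>f z\<bar> \<le> C" unfolding bounded_iff by fastforce
    have int_Cb: "integrable lborel (\<lambda>s. C * b s)" using int_b by (auto simp: has_bochner_integral_iff)
    \<comment> \<open>The substitution \<open>z = a + s / N n\<close> turns the approximate point mass into a fixed weight \<open>b\<close>
      of integral 1, against which \<open>f\<close> is evaluated closer and closer to \<open>a\<close>.\<close>
    have bd: "\<bar>f (a + s / N n) * b s\<bar> \<le> C * b s" for n s
    proof (cases "s \<in> {0..1}")
      case True
      then have "s / N n \<in> {0..1}" using N[of n] by (auto simp: divide_simps)
      then have "\<bar>f (a + s / N n)\<bar> \<le> C" by (intro C) auto
      then show ?thesis using b(1)[of s] by (simp add: abs_mult mult_right_mono)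
    qed (simp add: b)
    have int: "integrable lborel (\<lambda>s. f (a + s / N n) * b s)" for n
      by (rule Bochner_Integration.integrable_bound[OF int_Cb])
        (auto intro!: AE_I2 order_trans[OF bd])
    have N0: "N n \<noteq> 0" for n using N[of n] by auto
    show "integrable lborel (\<lambda>z. f z * (N n * b (N n * (z - a))))" for n
      using lborel_integrable_real_affine_iff[of "1 / N n" "\<lambda>z. f z * (N n * b (N n * (z - a)))" a]
        int[of n, THEN integrable_mult_left[where c = "N n"]] N0[of n] by (simp add: mult_ac)
    have eq: "(\<integral>z. f z * (N n * b (N n * (z - a))) \<partial>lborel) = (\<integral>s. f (a + s / N n) * b s \<partial>lborel)" for n
    proof -
      have "(\<integral>z. f z * (N n * b (N n * (z - a))) \<partial>lborel) =
          \<bar>1 / N n\<bar> *\<^sub>R (\<integral>s. N n * (f (a + s / N n) * b s) \<partial>lborel)"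
        using lborel_integral_real_affine[of "1 / N n" "\<lambda>z. f z * (N n * b (N n * (z - a)))" a] N0[of n]
        by (simp add: mult_ac)
      also have "\<dots> = (\<integral>s. f (a + s / N n) * b s \<partial>lborel)" using N[of n] by simp
      finally show ?thesis .
    qed
    have "(\<lambda>n. \<integral>s. f (a + s / N n) * b s \<partial>lborel) \<longlonglongrightarrow> (\<integral>s. f a * b s \<partial>lborel)"
    proof (rule integral_dominated_convergence[OF _ _ int_Cb])
      show "AE s in lborel. (\<lambda>n. f (a + s / N n) * b s) \<longlonglongrightarrow> f a * b s"
      proof (rule AE_I2, rule tendsto_mult_right)
        fix s
        have "(\<lambda>n. s / N n) \<longlonglongrightarrow> 0"
          unfolding N_def by (rule LIMSEQ_Suc[OF lim_const_over_n])
        then have "(\<lambda>n. a + s / N n) \<longlonglongrightarrow> a + 0" by (intro tendsto_intros)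
        moreover have "isCont f a" using f(2) by (simp add: continuous_on_eq_continuous_at)
        ultimately show "(\<lambda>n. f (a + s / N n)) \<longlonglongrightarrow> f a" by (intro isCont_tendsto_compose[of a f]) simp_all
      qed
    qed (use bd in auto)
    then show "(\<lambda>n. \<integral>z. f z * (N n * b (N n * (z - a))) \<partial>lborel) \<longlonglongrightarrow> f a"
      using int_b by (simp add: eq has_bochner_integral_iff)
  qed
  have "(\<lambda>n. \<integral>z. f z * \<phi>' n z \<partial>lborel) \<longlonglongrightarrow> f x - f y"
  proof -
    have "(\<integral>z. f z * \<phi>' n z \<partial>lborel) = (\<integral>z. f z * (N n * b (N n * (z - x))) \<partial>lborel)
        - (\<integral>z. f z * (N n * b (N n * (z - y))) \<partial>lborel)" for n
      using part(1)[of n x] part(1)[of n y] by (simp add: \<phi>'_def right_diff_distrib)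
    then show ?thesis using tendsto_diff[OF part(2)[of x] part(2)[of y]] by simp
  qed
  moreover have "(\<lambda>n. \<integral>z. f z * \<phi>' n z \<partial>lborel) \<longlonglongrightarrow> - (\<integral>z. indicator {x..y} z * w z \<partial>lborel)"
    unfolding eq by (intro tendsto_minus lim1)
  ultimately show ?thesis using LIMSEQ_unique by fastforce
qed

section \<open>Running means converge in the mean\<close>

lemma L2_lim_dominated:
  assumes "\<And>k. fs k \<in> L2" "f \<in> L2" "integrable lborel G"
    and "\<And>k x. (fs k x - f x)\<^sup>2 \<le> G x" "AE x in lborel. (\<lambda>k. fs k x) \<longlonglongrightarrow> f x"
  shows "L2_lim fs f sequentially"
proof -
  have "(\<lambda>k. \<integral>x. (fs k x - f x)\<^sup>2 \<partial>lborel) \<longlonglongrightarrow> integral\<^sup>L lborel (\<lambda>x::real. 0)"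
  proof (rule integral_dominated_convergence[OF _ _ assms(3)])
    show "(\<lambda>x. (fs k x - f x)\<^sup>2) \<in> borel_measurable lborel" for k
      using L2_measurable[OF L2_diff[OF assms(1,2)], of k] by simp
    show "AE x in lborel. (\<lambda>k. (fs k x - f x)\<^sup>2) \<longlonglongrightarrow> 0"
      using assms(5) by eventually_elim (auto intro!: tendsto_eq_intros)
    show "AE x in lborel. norm ((fs k x - f x)\<^sup>2) \<le> G x" for k
      using assms(4) by simp
  qed simp
  then have "(\<lambda>k. sqrt (\<integral>x. (fs k x - f x)\<^sup>2 \<partial>lborel)) \<longlonglongrightarrow> sqrt 0"
    by (intro tendsto_real_sqrt) simp
  then show ?thesis by (simp add: L2_norm_def)
qed

lemma L2_continuous_compact_support:
  fixes g :: "real \<Rightarrow> real"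
  assumes g: "continuous_on UNIV g" and R: "\<And>x. \<bar>x\<bar> > R \<Longrightarrow> g x = 0"
  shows "g \<in> L2"
proof -
  have "bounded (g ` {-R..R})"
    by (intro compact_imp_bounded compact_continuous_image continuous_on_subset[OF g]) auto
  then obtain C where C: "\<And>x. x \<in> {-R..R} \<Longrightarrow> \<bar>g x\<bar> \<le> C" unfolding bounded_iff by fastforce
  have "\<bar>g x\<bar> \<le> C * \<bar>indicator {-R..R} x\<bar>" for x
    using C[of x] R[of x] by (cases "x \<in> {-R..R}") auto
  then show ?thesis
    by (rule L2_dominated[OF L2_indicator borel_measurable_continuous_onI[OF g]])
qed

text \<open>
  Truncate \<open>w\<close> in height and in space, and then replace it by continuous functions that converge to it
  almost everywhere; the truncation keeps the second step dominated.
\<close>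
lemma continuous_dense_in_L2:
  assumes w: "w \<in> L2" and "\<epsilon> > 0"
  obtains g R where "continuous_on UNIV g" "\<And>x. \<bar>x\<bar> > R \<Longrightarrow> g x = 0" "L2_norm (\<lambda>x. w x - g x) < \<epsilon>"
proof -
  \<comment> \<open>\<open>c\<close> clamps values to \<open>[- n, n]\<close>, \<open>\<eta>\<close> is a continuous cutoff equal to 1 on \<open>[- n, n]\<close>.\<close>
  define c where "c n y = max (- real n) (min (real n) y)" for n y
  define \<eta> where "\<eta> n x = max 0 (min 1 (real n + 1 - \<bar>x\<bar>))" for n and x :: real
  have [measurable]: "w \<in> borel_measurable borel" by (rule L2_measurable[OF w])
  have c_cont: "continuous_on UNIV (c n)" for n unfolding c_def by (intro continuous_intros)
  have \<eta>_cont: "continuous_on UNIV (\<eta> n)" for n unfolding \<eta>_def by (intro continuous_intros)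
  have c_bd: "\<bar>c n y\<bar> \<le> real n" "\<bar>c n y\<bar> \<le> \<bar>y\<bar>" "\<bar>c n y - y\<bar> \<le> \<bar>y\<bar>" for n y by (auto simp: c_def)
  have \<eta>_bd: "0 \<le> \<eta> n x" "\<eta> n x \<le> 1" "\<bar>x\<bar> > real n + 1 \<Longrightarrow> \<eta> n x = 0" for n x by (auto simp: \<eta>_def)
  define W where "W n x = \<eta> n x * c n (w x)" for n x
  have W_meas: "W n \<in> borel_measurable borel" for n
    unfolding W_def c_def \<eta>_def by measurable
  have "\<bar>W n x\<bar> \<le> 1 * \<bar>w x\<bar>" for n x
    unfolding W_def abs_mult using \<eta>_bd[of n x] c_bd(2)[of n "w x"] by (intro mult_mono) auto
  then have W: "W n \<in> L2" for n by (rule L2_dominated[OF w W_meas])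
  have "L2_lim W w sequentially"
  proof (rule L2_lim_dominated[OF W w, where G="\<lambda>x. (w x)\<^sup>2"])
    show "integrable lborel (\<lambda>x. (w x)\<^sup>2)" by (rule L2_square_integrable[OF w])
    fix n x
    have "\<bar>W n x - w x\<bar> \<le> \<bar>w x\<bar>"
    proof -
      have 1: "0 \<le> c n (w x) \<and> c n (w x) \<le> w x \<or> w x \<le> c n (w x) \<and> c n (w x) \<le> 0"
        by (auto simp: c_def)
      then have "0 \<le> W n x \<and> W n x \<le> w x \<or> w x \<le> W n x \<and> W n x \<le> 0"
      proof
        assume *: "0 \<le> c n (w x) \<and> c n (w x) \<le> w x"
        then have "W n x \<le> 1 * c n (w x)" "0 \<le> W n x"
          unfolding W_def using \<eta>_bd[of n x] by (intro mult_right_mono mult_nonneg_nonneg; simp)+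
        then show ?thesis using * by simp
      next
        assume *: "w x \<le> c n (w x) \<and> c n (w x) \<le> 0"
        then have "W n x \<ge> 1 * c n (w x)" "0 \<ge> W n x"
          unfolding W_def using \<eta>_bd[of n x] by (intro mult_right_mono_neg mult_nonneg_nonpos; simp)+
        then show ?thesis using * by simp
      qed
      then show ?thesis by auto
    qed
    then show "(W n x - w x)\<^sup>2 \<le> (w x)\<^sup>2" by (simp add: abs_le_square_iff)
  next
    show "AE x in lborel. (\<lambda>n. W n x) \<longlonglongrightarrow> w x"
    proof (rule AE_I2, rule tendsto_eventually)
      fix x
      obtain m where m: "real m \<ge> \<bar>x\<bar> + \<bar>w x\<bar>" using real_arch_simple by blast
      show "\<forall>\<^sub>F n in sequentially. W n x = w x"
        by (rule eventually_mono[OF eventually_ge_at_top[of m]])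
          (use m in \<open>auto simp: W_def c_def \<eta>_def\<close>)
    qed
  qed
  then have "\<forall>\<^sub>F n in sequentially. L2_norm (\<lambda>x. W n x - w x) < \<epsilon> / 2"
    by (rule order_tendstoD(2)) (use \<open>\<epsilon> > 0\<close> in simp)
  then obtain n where n: "L2_norm (\<lambda>x. W n x - w x) < \<epsilon> / 2" by (auto simp: eventually_sequentially)
  have "w measurable_on UNIV"
    by (rule lebesgue_measurable_imp_measurable_on_real) (auto intro: borel_measurable_subalgebra[of borel] simp: measurable_completion)
  then obtain N g where N: "negligible N" and g: "\<And>k. continuous_on UNIV (g k)"
      "\<And>x. x \<notin> N \<Longrightarrow> (\<lambda>k. g k x) \<longlonglongrightarrow> w x"
    unfolding measurable_on_def by auto
  define h where "h k x = \<eta> n x * c n (g k x)" for k x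
  have h_cont: "continuous_on UNIV (h k)" for k
    unfolding h_def using g(1)
    by (intro continuous_on_mult \<eta>_cont continuous_on_compose2[OF c_cont]) auto
  have h0: "\<bar>x\<bar> > real n + 1 \<Longrightarrow> h k x = 0" for k x using \<eta>_bd(3) by (simp add: h_def)
  have hL2: "h k \<in> L2" for k by (rule L2_continuous_compact_support[OF h_cont h0])
  have "L2_lim h (W n) sequentially"
  proof (rule L2_lim_dominated[OF hL2 W, where G="\<lambda>x. 4 * (real n)\<^sup>2 * indicator {- (real n + 1)..real n + 1} x"])
    show "integrable lborel (\<lambda>x. 4 * (real n)\<^sup>2 * indicator {- (real n + 1)..real n + 1} x)"
      by (intro integrable_mult_right integrable_real_indicator) (auto simp: emeasure_lborel_Icc_eq)
    show "(h k x - W n x)\<^sup>2 \<le> 4 * (real n)\<^sup>2 * indicator {- (real n + 1)..real n + 1} x" for k x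
    proof (cases "x \<in> {- (real n + 1)..real n + 1}")
      case True
      have "\<bar>h k x\<bar> \<le> 1 * real n" "\<bar>W n x\<bar> \<le> 1 * real n"
        unfolding h_def W_def abs_mult using \<eta>_bd[of n x] c_bd(1) by (intro mult_mono; simp)+
      then have "\<bar>h k x - W n x\<bar> \<le> \<bar>2 * real n\<bar>" by simp
      then have "(h k x - W n x)\<^sup>2 \<le> (2 * real n)\<^sup>2" by (simp only: abs_le_square_iff)
      then show ?thesis using True by (simp add: power_mult_distrib)
    next
      case False
      then have "\<eta> n x = 0" by (intro \<eta>_bd) auto
      then show ?thesis by (simp add: h_def W_def)
    qed
    have "N \<in> null_sets lebesgue" using N by (simp add: negligible_iff_null_sets)
    then have "AE x in lebesgue. x \<notin> N" by (rule AE_not_in)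
    then have "AE x in lebesgue. (\<lambda>k. h k x) \<longlonglongrightarrow> W n x"
    proof eventually_elim
      case (elim x)
      have "isCont (c n) (w x)" using c_cont by (simp add: continuous_on_eq_continuous_at)
      then have "(\<lambda>k. c n (g k x)) \<longlonglongrightarrow> c n (w x)" using g(2)[OF elim] by (rule isCont_tendsto_compose)
      then show ?case unfolding h_def W_def by (rule tendsto_mult_left)
    qed
    then show "AE x in lborel. (\<lambda>k. h k x) \<longlonglongrightarrow> W n x" by (simp add: AE_completion_iff)
  qed
  then have "\<forall>\<^sub>F k in sequentially. L2_norm (\<lambda>x. h k x - W n x) < \<epsilon> / 2"
    by (rule order_tendstoD(2)) (use \<open>\<epsilon> > 0\<close> in simp)
  then obtain k where k: "L2_norm (\<lambda>x. h k x - W n x) < \<epsilon> / 2" by (auto simp: eventually_sequentially)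
  have "L2_norm (\<lambda>x. h k x - w x) < \<epsilon>"
    using L2_norm_triangle[OF hL2[of k] w W[of n]] n k by linarith
  then show thesis
    unfolding L2_norm_minus_commute[of "h k" w] by (intro that[of "h k" "real n + 1"] h_cont h0)
qed

definition running_mean :: "real \<Rightarrow> (real \<Rightarrow> real) \<Rightarrow> real \<Rightarrow> real" where
  "running_mean s w x = (\<integral>r. indicator {0..s} r * w (x + r) \<partial>lborel) / s"

lemma integrable_window: "w \<in> L2 \<Longrightarrow> integrable lborel (\<lambda>r. indicator {a..b} r * w (x + r))"
  using L2_mult_integrable[OF L2_indicator L2_shift[of w x]] by (simp add: add.commute)

lemma L2_norm_indicator: "a \<le> b \<Longrightarrow> (L2_norm (indicator {a..b}))\<^sup>2 = b - a"
proof -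
  have "(\<lambda>x. (indicator {a..b} x)\<^sup>2) = (indicator {a..b} :: real \<Rightarrow> real)" by (auto simp: indicator_def)
  then show "a \<le> b \<Longrightarrow> ?thesis" by (simp add: L2_norm_square)
qed

text \<open>
  Cauchy-Schwarz on the window bounds the square of the mean by the mean of the square, whose
  integral is that of \<open>w\<^sup>2\<close>.
\<close>
lemma running_mean_L2:
  assumes w: "w \<in> L2" and s: "s > 0"
  shows "running_mean s w \<in> L2" and "L2_norm (running_mean s w) \<le> L2_norm w"
proof -
  have [measurable]: "w \<in> borel_measurable borel" by (rule L2_measurable[OF w])
  let ?I = "indicator {0..s} :: real \<Rightarrow> real"
  let ?M = "\<lambda>x. \<integral>r. ?I r * (w (x + r))\<^sup>2 \<partial>lborel"
  have I_int: "integrable lborel ?I" by (rule integrable_real_indicator) (auto simp: emeasure_lborel_Icc_eq)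
  have II: "(\<integral>r. ?I r \<partial>lborel) = s" using s by simp
  have ptw: "(running_mean s w x)\<^sup>2 \<le> ?M x / s" for x
  proof -
    have w': "(\<lambda>r. ?I r * w (x + r)) \<in> L2"
      using L2_shift[OF w, of x] by (intro L2_mult_bounded[where B=1]) (auto simp: add.commute indicator_def)
    have "\<bar>\<integral>r. ?I r * (?I r * w (x + r)) \<partial>lborel\<bar> \<le> L2_norm ?I * L2_norm (\<lambda>r. ?I r * w (x + r))"
      by (rule L2_Cauchy_Schwarz[OF L2_indicator w'])
    then have "\<bar>\<integral>r. ?I r * (?I r * w (x + r)) \<partial>lborel\<bar>\<^sup>2 \<le> (L2_norm ?I * L2_norm (\<lambda>r. ?I r * w (x + r)))\<^sup>2"
      by (rule power_mono) simp
    then have "(\<integral>r. ?I r * (?I r * w (x + r)) \<partial>lborel)\<^sup>2 \<le> (L2_norm ?I)\<^sup>2 * (L2_norm (\<lambda>r. ?I r * w (x + r)))\<^sup>2"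
      by (simp only: power_mult_distrib power2_abs)
    moreover have "(\<lambda>r. ?I r * (?I r * w (x + r))) = (\<lambda>r. ?I r * w (x + r))"
      "(\<lambda>r. (?I r * w (x + r))\<^sup>2) = (\<lambda>r. ?I r * (w (x + r))\<^sup>2)"
      by (auto simp: indicator_def)
    moreover have "(L2_norm ?I)\<^sup>2 = s" using s by (simp add: L2_norm_indicator)
    ultimately have "(\<integral>r. ?I r * w (x + r) \<partial>lborel)\<^sup>2 \<le> s * ?M x"
      by (simp only: L2_norm_square)
    then show ?thesis using s by (simp add: running_mean_def field_simps power2_eq_square)
  qed
  have M_int: "integrable lborel (\<lambda>x. ?M x / s)"
    using correlation(1)[OF I_int L2_square_integrable[OF w]] by simp
  have meas: "running_mean s w \<in> borel_measurable borel"
    unfolding running_mean_def by measurable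
  have "integrable lborel (\<lambda>x. (running_mean s w x)\<^sup>2)"
    by (rule Bochner_Integration.integrable_bound[OF M_int])
      (use meas s in \<open>auto intro!: AE_I2 order_trans[OF ptw]\<close>)
  then show L2: "running_mean s w \<in> L2" using meas by (simp add: L2_def)
  have "(\<integral>x. (running_mean s w x)\<^sup>2 \<partial>lborel) \<le> (\<integral>x. ?M x / s \<partial>lborel)"
    by (rule integral_mono[OF L2_square_integrable[OF L2] M_int ptw])
  also have "\<dots> = (\<integral>x. (w x)\<^sup>2 \<partial>lborel)"
    using correlation(2)[OF I_int L2_square_integrable[OF w]] s unfolding II by simp
  finally show "L2_norm (running_mean s w) \<le> L2_norm w"
    unfolding L2_norm_def by (rule real_sqrt_le_mono)
qed

lemma running_mean_diff:
  assumes "v \<in> L2" "w \<in> L2"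
  shows "running_mean s (\<lambda>x. v x - w x) x = running_mean s v x - running_mean s w x"
  using integrable_window[OF assms(1), of 0 s x] integrable_window[OF assms(2), of 0 s x]
  by (simp add: running_mean_def right_diff_distrib diff_divide_distrib)

text \<open>
  Running means are contractions of \<open>L\<^sup>2\<close>, so the claim passes from continuous functions with compact
  support, where uniform continuity gives it, to all of \<open>L\<^sup>2\<close>.
\<close>
lemma running_mean_tendsto:
  assumes w: "w \<in> L2"
  shows "L2_lim (\<lambda>s. running_mean s w) w (at_right 0)"
proof (rule tendstoI)
  fix \<epsilon> :: real assume "\<epsilon> > 0"
  then obtain g R where g: "continuous_on UNIV g" "\<And>x. \<bar>x\<bar> > R \<Longrightarrow> g x = 0" and wg: "L2_norm (\<lambda>x. w x - g x) < \<epsilon> / 3"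
    using continuous_dense_in_L2[OF w, of "\<epsilon> / 3"] by auto
  have gL2: "g \<in> L2" by (rule L2_continuous_compact_support[OF g])
  \<comment> \<open>Windows of length below 1 move the support of \<open>g\<close> by less than 1, so everything happens in \<open>[- Q, Q]\<close>.\<close>
  define Q where "Q = \<bar>R\<bar> + 1"
  define \<delta> where "\<delta> = \<epsilon> / 3 / (1 + L2_norm (indicator {-Q..Q}))"
  have \<delta>: "\<delta> > 0" "\<delta> * L2_norm (indicator {-Q..Q}) < \<epsilon> / 3"
  proof -
    have "1 + L2_norm (indicator {-Q..Q}) > 0" using L2_norm_nonneg[of "indicator {-Q..Q}"] by linarith
    then show "\<delta> > 0" "\<delta> * L2_norm (indicator {-Q..Q}) < \<epsilon> / 3"
      using \<open>\<epsilon> > 0\<close> by (simp_all add: \<delta>_def field_simps)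
  qed
  have "uniformly_continuous_on {-(Q + 1)..Q + 1} g"
    by (intro compact_uniformly_continuous continuous_on_subset[OF g(1)]) auto
  then obtain d where d: "d > 0" "\<And>x y. x \<in> {-(Q + 1)..Q + 1} \<Longrightarrow> y \<in> {-(Q + 1)..Q + 1} \<Longrightarrow> dist y x < d \<Longrightarrow> dist (g y) (g x) < \<delta>"
    unfolding uniformly_continuous_on_def using \<delta>(1) by meson
  have "\<forall>\<^sub>F s in at_right 0. s < min 1 d" using d(1) by (intro eventually_at_right_real[THEN eventually_mono, of 0 "min 1 d"]) auto
  then show "\<forall>\<^sub>F s in at_right 0. dist (L2_norm (\<lambda>x. running_mean s w x - w x)) 0 < \<epsilon>"
    using eventually_at_right_less[of "0::real"]
  proof eventually_elim
    case (elim s)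
    have mg: "\<bar>running_mean s g x - g x\<bar> \<le> \<bar>\<delta> * indicator {-Q..Q} x\<bar>" for x
    proof -
      have bd: "\<bar>indicator {0..s} r * (g (x + r) - g x)\<bar> \<le> indicator {0..s} r * (\<delta> * indicator {-Q..Q} x)" for r
      proof (cases "r \<in> {0..s}")
        case True
        show ?thesis
        proof (cases "x \<in> {-Q..Q}")
          case x: True
          have "\<bar>g (x + r) - g x\<bar> < \<delta>"
            using d(2)[of x "x + r"] x True elim by (auto simp: dist_real_def)
          then show ?thesis using x True by simp
        next
          case False
          then have "g x = 0" "g (x + r) = 0" using True elim by (auto intro!: g simp: Q_def)
          then show ?thesis using False by simp
        qed
      qed simp
      have sI: "integrable lborel (\<lambda>r. indicator {0..s} r * c)" for c :: real
        by (intro integrable_mult_left integrable_real_indicator) (auto simp: emeasure_lborel_Icc_eq)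
      have "running_mean s g x - g x = (\<integral>r. indicator {0..s} r * (g (x + r) - g x) \<partial>lborel) / s"
        using integrable_window[OF gL2, of 0 s x] sI[of "g x"] elim
        by (simp add: running_mean_def right_diff_distrib field_simps)
      also have "\<bar>\<dots>\<bar> \<le> (\<integral>r. indicator {0..s} r * (\<delta> * indicator {-Q..Q} x) \<partial>lborel) / s"
      proof -
        have "\<bar>\<integral>r. indicator {0..s} r * (g (x + r) - g x) \<partial>lborel\<bar> \<le> (\<integral>r. \<bar>indicator {0..s} r * (g (x + r) - g x)\<bar> \<partial>lborel)"
          by (rule integral_abs_bound)
        also have "\<dots> \<le> (\<integral>r. indicator {0..s} r * (\<delta> * indicator {-Q..Q} x) \<partial>lborel)"
          using integrable_window[OF gL2, of 0 s x] sI[of "g x"]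
          by (intro integral_mono sI bd integrable_abs) (simp add: right_diff_distrib)
        finally have *: "\<bar>\<integral>r. indicator {0..s} r * (g (x + r) - g x) \<partial>lborel\<bar> \<le> (\<integral>r. indicator {0..s} r * (\<delta> * indicator {-Q..Q} x) \<partial>lborel)" .
        have "\<bar>I / s\<bar> = \<bar>I\<bar> / s" for I using elim by simp
        then show ?thesis using divide_right_mono[OF *, of s] elim by (simp only: less_imp_le)
      qed
      also have "\<dots> = \<delta> * indicator {-Q..Q} x" using elim by simp
      also have "\<dots> \<le> \<bar>\<delta> * indicator {-Q..Q} x\<bar>" by simp
      finally show ?thesis .
    qed
    have mgL2: "running_mean s g \<in> L2" and mwL2: "running_mean s w \<in> L2" using running_mean_L2 gL2 w elim by auto
    have "L2_norm (\<lambda>x. running_mean s g x - g x) \<le> L2_norm (\<lambda>x. \<delta> * indicator {-Q..Q} x)"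
      by (intro L2_norm_mono L2_cmult L2_indicator L2_diff mgL2 gL2 mg)
    then have 1: "L2_norm (\<lambda>x. running_mean s g x - g x) < \<epsilon> / 3" using \<delta> by (simp add: L2_norm_cmult)
    have 2: "L2_norm (\<lambda>x. running_mean s w x - running_mean s g x) < \<epsilon> / 3"
      using running_mean_L2(2)[OF L2_diff[OF w gL2], of s] elim wg by (simp add: running_mean_diff[OF w gL2, abs_def] running_mean_diff[OF w gL2])
    have 3: "L2_norm (\<lambda>x. g x - w x) < \<epsilon> / 3" using wg unfolding L2_norm_minus_commute[of g w] .
    show ?case
      using L2_norm_triangle[OF mwL2 w mgL2] L2_norm_triangle[OF mgL2 w gL2] 1 2 3 by simp
  qed
qed

section \<open>Difference quotients of functions with a square integrable derivative\<close>

text \<open>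
  For a continuous \<open>f\<close> this is equivalent to \<open>w\<close> being the weak derivative. The integral over a fixed
  window keeps the notion visibly stable under translations and linear combinations, and exhibits
  difference quotients of \<open>f\<close> as running means of \<open>w\<close>.
\<close>
definition has_L2_derivative :: "(real \<Rightarrow> real) \<Rightarrow> (real \<Rightarrow> real) \<Rightarrow> bool" where
  "has_L2_derivative f w \<longleftrightarrow> f \<in> L2 \<and> w \<in> L2 \<and>
     (\<forall>x. \<forall>s\<ge>0. f (x + s) - f x = (\<integral>r. indicator {0..s} r * w (x + r) \<partial>lborel))"

lemma has_L2_derivativeD:
  assumes "has_L2_derivative f w"
  shows "f \<in> L2" "w \<in> L2" "s \<ge> 0 \<Longrightarrow> f (x + s) - f x = (\<integral>r. indicator {0..s} r * w (x + r) \<partial>lborel)"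
  using assms by (auto simp: has_L2_derivative_def)

lemma has_L2_derivativeI:
  assumes "f \<in> L2" "continuous_on UNIV f" "has_weak_L2_deriv f w"
  shows "has_L2_derivative f w"
  unfolding has_L2_derivative_def
proof (intro conjI allI impI)
  show "f \<in> L2" "w \<in> L2" using assms by (auto simp: has_weak_L2_deriv_def)
  fix x s :: real assume "0 \<le> s"
  then have "f (x + s) - f x = (\<integral>z. indicator {x..x + s} z * w z \<partial>lborel)"
    by (intro weak_derivative_FTC[OF assms]) simp
  also have "\<dots> = (\<integral>r. indicator {x..x + s} (r + x) * w (r + x) \<partial>lborel)"
    by (rule integral_shift[symmetric])
  also have "\<dots> = (\<integral>r. indicator {0..s} r * w (x + r) \<partial>lborel)"
    by (intro Bochner_Integration.integral_cong) (auto simp: indicator_def add.commute)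
  finally show "f (x + s) - f x = (\<integral>r. indicator {0..s} r * w (x + r) \<partial>lborel)" .
qed

lemma has_L2_derivative_shift:
  assumes "has_L2_derivative f w"
  shows "has_L2_derivative (\<lambda>x. f (x + h)) (\<lambda>x. w (x + h))"
  unfolding has_L2_derivative_def
proof (intro conjI allI impI L2_shift has_L2_derivativeD[OF assms])
  fix x s :: real assume "s \<ge> 0"
  from has_L2_derivativeD(3)[OF assms this, of "x + h"]
  show "f (x + s + h) - f (x + h) = (\<integral>r. indicator {0..s} r * w (x + r + h) \<partial>lborel)"
    by (simp add: algebra_simps)
qed

lemma has_L2_derivative_diff:
  assumes "has_L2_derivative f v" "has_L2_derivative g w"
  shows "has_L2_derivative (\<lambda>x. f x - g x) (\<lambda>x. v x - w x)"
  unfolding has_L2_derivative_def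
proof (intro conjI allI impI L2_diff has_L2_derivativeD(1,2)[OF assms(1)] has_L2_derivativeD(1,2)[OF assms(2)])
  fix x s :: real assume s: "s \<ge> 0"
  show "f (x + s) - g (x + s) - (f x - g x) = (\<integral>r. indicator {0..s} r * (v (x + r) - w (x + r)) \<partial>lborel)"
    using has_L2_derivativeD(3)[OF assms(1) s, of x] has_L2_derivativeD(3)[OF assms(2) s, of x]
      integrable_window[OF has_L2_derivativeD(2)[OF assms(1)], of 0 s x]
      integrable_window[OF has_L2_derivativeD(2)[OF assms(2)], of 0 s x]
    by (simp add: right_diff_distrib)
qed

lemma has_L2_derivative_divide:
  assumes "has_L2_derivative f w"
  shows "has_L2_derivative (\<lambda>x. f x / c) (\<lambda>x. w x / c)"
  unfolding has_L2_derivative_def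
proof (intro conjI allI impI L2_divide has_L2_derivativeD(1,2)[OF assms])
  fix x s :: real assume s: "s \<ge> 0"
  show "f (x + s) / c - f x / c = (\<integral>r. indicator {0..s} r * (w (x + r) / c) \<partial>lborel)"
    using has_L2_derivativeD(3)[OF assms s, of x] by (simp add: diff_divide_distrib[symmetric])
qed

abbreviation diff_quot :: "real \<Rightarrow> (real \<Rightarrow> real) \<Rightarrow> real \<Rightarrow> real" where
  "diff_quot s f x \<equiv> (f (x + s) - f x) / s"

lemma diff_quot_L2: "f \<in> L2 \<Longrightarrow> diff_quot s f \<in> L2"
  by (intro L2_divide L2_diff L2_shift)

lemma has_L2_derivative_diff_quot:
  "has_L2_derivative f w \<Longrightarrow> has_L2_derivative (diff_quot s f) (diff_quot s w)"
  by (intro has_L2_derivative_divide has_L2_derivative_diff has_L2_derivative_shift)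

lemma diff_quot_running_mean:
  assumes "has_L2_derivative f w" "s > 0"
  shows "diff_quot s f = running_mean s w"
  using has_L2_derivativeD(3)[OF assms(1), of s] assms(2) by (auto simp: running_mean_def)

lemma L2_norm_diff_quot:
  assumes "has_L2_derivative f w" "s > 0"
  shows "L2_norm (diff_quot s f) \<le> L2_norm w"
  unfolding diff_quot_running_mean[OF assms]
  by (rule running_mean_L2[OF has_L2_derivativeD(2)[OF assms(1)] assms(2)])

lemma diff_quot_tendsto:
  assumes "has_L2_derivative f w"
  shows "L2_lim (\<lambda>s. diff_quot s f) w (at_right 0)"
proof (rule Lim_transform_eventually)
  show "L2_lim (\<lambda>s. running_mean s w) w (at_right 0)"
    by (rule running_mean_tendsto[OF has_L2_derivativeD(2)[OF assms]])
  show "\<forall>\<^sub>F s in at_right 0. L2_norm (\<lambda>x. running_mean s w x - w x) = L2_norm (\<lambda>x. diff_quot s f x - w x)"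
    using eventually_at_right_less[of "0::real"]
    by eventually_elim (simp add: diff_quot_running_mean[OF assms, symmetric])
qed

lemma shift_tendsto:
  assumes "has_L2_derivative f w"
  shows "L2_lim (\<lambda>s x. f (x + s)) f (at_right 0)"
proof (rule Lim_null_comparison)
  show "((\<lambda>s. s * L2_norm w) \<longlongrightarrow> 0) (at_right 0)" by (auto intro!: tendsto_eq_intros)
  show "\<forall>\<^sub>F s in at_right 0. norm (L2_norm (\<lambda>x. f (x + s) - f x)) \<le> s * L2_norm w"
    using eventually_at_right_less[of "0::real"]
  proof eventually_elim
    case (elim s)
    then show ?case using L2_norm_diff_quot[OF assms elim] by (simp add: L2_norm_divide field_simps)
  qed
qed

lemma has_L2_derivative_unique:
  assumes "has_L2_derivative f v" "has_L2_derivative f w"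
  shows "AE x in lborel. v x = w x"
  by (rule L2_lim_unique[OF _ has_L2_derivativeD(2)[OF assms(1)] has_L2_derivativeD(2)[OF assms(2)]
        diff_quot_tendsto[OF assms(1)] diff_quot_tendsto[OF assms(2)]])
    (simp_all add: diff_quot_L2 has_L2_derivativeD(1)[OF assms(1)])

text \<open>
  Compare \<open>f x\<close> with \<open>f (x + r)\<close> and average over \<open>r \<in> [0, 1]\<close>.
\<close>
lemma Sobolev_pointwise:
  assumes "has_L2_derivative f w"
  shows "\<bar>f x\<bar> \<le> L2_norm f + L2_norm w"
proof -
  note f = has_L2_derivativeD(1)[OF assms] and w = has_L2_derivativeD(2)[OF assms]
  let ?I = "indicator {0..1} :: real \<Rightarrow> real"
  have I1: "L2_norm ?I = 1" 
  proof -
    have "L2_norm ?I = sqrt ((L2_norm ?I)\<^sup>2)" by (simp del: L2_norm_square)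
    then show ?thesis unfolding L2_norm_indicator[OF zero_le_one] by simp
  qed
  have bd: "(\<integral>r. ?I r * \<bar>g (x + r)\<bar> \<partial>lborel) \<le> L2_norm g" if g: "g \<in> L2" for g
  proof -
    have g': "(\<lambda>r. \<bar>g (x + r)\<bar>) \<in> L2" using L2_shift[OF g, of x] by (auto simp: L2_def add.commute)
    have "L2_norm (\<lambda>r. \<bar>g (x + r)\<bar>) = L2_norm g"
      using L2_norm_shift[of g x] by (simp add: L2_norm_def add.commute)
    then show ?thesis using L2_Cauchy_Schwarz[OF L2_indicator[of 0 1] g'] I1 by simp
  qed
  have abs_int: "integrable lborel (\<lambda>r. ?I r * \<bar>g (x + r)\<bar>)" if g: "g \<in> L2" for g
  proof (rule integrable_window)
    show "(\<lambda>x. \<bar>g x\<bar>) \<in> L2" using g by (auto simp: L2_def)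
  qed
  have I_int: "integrable lborel (\<lambda>r. ?I r * c)" for c :: real
    by (intro integrable_mult_left integrable_real_indicator) auto
  have ptw: "?I r * \<bar>f x\<bar> \<le> ?I r * \<bar>f (x + r)\<bar> + ?I r * L2_norm w" for r
  proof (cases "r \<in> {0..1}")
    case True
    have "\<bar>f (x + r) - f x\<bar> = \<bar>\<integral>\<rho>. indicator {0..r} \<rho> * w (x + \<rho>) \<partial>lborel\<bar>"
      using has_L2_derivativeD(3)[OF assms, of r x] True by simp
    also have "\<dots> \<le> (\<integral>\<rho>. \<bar>indicator {0..r} \<rho> * w (x + \<rho>)\<bar> \<partial>lborel)" by (rule integral_abs_bound)
    also have "\<dots> \<le> (\<integral>\<rho>. ?I \<rho> * \<bar>w (x + \<rho>)\<bar> \<partial>lborel)"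
      using True by (intro integral_mono integrable_abs integrable_window w abs_int) (auto simp: indicator_def)
    also have "\<dots> \<le> L2_norm w" by (rule bd[OF w])
    finally show ?thesis using True by simp
  qed simp
  have "\<bar>f x\<bar> = (\<integral>r. ?I r * \<bar>f x\<bar> \<partial>lborel)" by simp
  also have "\<dots> \<le> (\<integral>r. ?I r * \<bar>f (x + r)\<bar> + ?I r * L2_norm w \<partial>lborel)"
    by (intro integral_mono Bochner_Integration.integrable_add I_int abs_int f ptw)
  also have "\<dots> = (\<integral>r. ?I r * \<bar>f (x + r)\<bar> \<partial>lborel) + (\<integral>r. ?I r * L2_norm w \<partial>lborel)"
    by (intro Bochner_Integration.integral_add I_int abs_int f)
  also have "\<dots> \<le> L2_norm f + L2_norm w" using bd[OF f] by simp
  finally show ?thesis .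
qed

lemma test_function_L2:
  assumes "test_function \<phi>"
  shows "\<phi> \<in> L2" "deriv \<phi> \<in> L2"
proof -
  from assms obtain R where sm: "\<And>n x. (deriv ^^ n) \<phi> field_differentiable at x" and R: "\<And>x. \<bar>x\<bar> > R \<Longrightarrow> \<phi> x = 0"
    by (auto simp: test_function_def)
  have c: "continuous_on UNIV \<phi>" "continuous_on UNIV (deriv \<phi>)"
    using sm[of 0] sm[of 1]
    by (auto simp: continuous_on_eq_continuous_at intro!: field_differentiable_imp_continuous_at)
  show "\<phi> \<in> L2" by (rule L2_continuous_compact_support[OF c(1) R])
  have "deriv \<phi> x = 0" if "\<bar>x\<bar> > R" for x
  proof (rule DERIV_imp_deriv, rule has_field_derivative_transform_within_open[where S="{y. \<bar>y\<bar> > R}" and f="\<lambda>x. 0"])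
    show "open {y. R < \<bar>y\<bar>}" by (intro open_Collect_less continuous_intros)
  qed (use that R in auto)
  then show "deriv \<phi> \<in> L2" by (rule L2_continuous_compact_support[OF c(2)])
qed

lemma has_weak_L2_deriv_diff:
  assumes "f \<in> L2" "g \<in> L2" "has_weak_L2_deriv f v" "has_weak_L2_deriv g w"
  shows "has_weak_L2_deriv (\<lambda>x. f x - g x) (\<lambda>x. v x - w x)"
proof -
  have vw: "v \<in> L2" "w \<in> L2" using assms by (auto simp: has_weak_L2_deriv_def)
  have "(\<integral>x. (f x - g x) * deriv \<phi> x \<partial>lborel) = - (\<integral>x. (v x - w x) * \<phi> x \<partial>lborel)" if t: "test_function \<phi>" for \<phi>
  proof -
    have eqs: "(\<integral>x. f x * deriv \<phi> x \<partial>lborel) = - (\<integral>x. v x * \<phi> x \<partial>lborel)"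
        "(\<integral>x. g x * deriv \<phi> x \<partial>lborel) = - (\<integral>x. w x * \<phi> x \<partial>lborel)"
      using assms t by (auto simp: has_weak_L2_deriv_def)
    show ?thesis
      using L2_mult_integrable[OF assms(1) test_function_L2(2)[OF t]] L2_mult_integrable[OF assms(2) test_function_L2(2)[OF t]]
        L2_mult_integrable[OF vw(1) test_function_L2(1)[OF t]] L2_mult_integrable[OF vw(2) test_function_L2(1)[OF t]]
      by (simp add: left_diff_distrib eqs)
  qed
  then show ?thesis using L2_diff[OF vw] by (simp add: has_weak_L2_deriv_def)
qed

lemma has_weak_L2_deriv_weak_deriv: "f \<in> H1 \<Longrightarrow> has_weak_L2_deriv f (weak_deriv f)"
  unfolding weak_deriv_def by (rule someI_ex[of "has_weak_L2_deriv f"]) (simp add: H1_def)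

lemma H1_has_L2_derivative:
  assumes "f \<in> H1" "continuous_on UNIV f"
  shows "has_L2_derivative f (weak_deriv f)"
  using assms by (intro has_L2_derivativeI has_weak_L2_deriv_weak_deriv) (auto simp: H1_def)

lemma H1_diff: assumes "f \<in> H1" "g \<in> H1" shows "(\<lambda>x. f x - g x) \<in> H1"
  using has_weak_L2_deriv_diff[OF _ _ has_weak_L2_deriv_weak_deriv[OF assms(1)] has_weak_L2_deriv_weak_deriv[OF assms(2)]]
    assms L2_diff[of f g] by (auto simp: H1_def)

text \<open>
  \<open>weak_deriv\<close> picks a representative for each function separately, so it is additive only up to null
  sets.
\<close>
lemma L2_norm_weak_deriv_diff:
  assumes "f \<in> H1" "g \<in> H1" "continuous_on UNIV f" "continuous_on UNIV g"
  shows "L2_norm (weak_deriv (\<lambda>x. f x - g x)) = L2_norm (\<lambda>x. weak_deriv f x - weak_deriv g x)"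
proof (rule L2_norm_cong_AE)
  have d: "has_L2_derivative (\<lambda>x. f x - g x) (weak_deriv (\<lambda>x. f x - g x))"
    using assms by (intro H1_has_L2_derivative H1_diff continuous_intros)
  have e: "has_L2_derivative (\<lambda>x. f x - g x) (\<lambda>x. weak_deriv f x - weak_deriv g x)"
    using assms by (intro has_L2_derivative_diff H1_has_L2_derivative)
  show "AE x in lborel. weak_deriv (\<lambda>x. f x - g x) x = weak_deriv f x - weak_deriv g x"
    by (rule has_L2_derivative_unique[OF d e])
  show "weak_deriv (\<lambda>x. f x - g x) \<in> L2" "(\<lambda>x. weak_deriv f x - weak_deriv g x) \<in> L2"
    using has_L2_derivativeD(2)[OF d] has_L2_derivativeD(2)[OF e] .
qed

text \<open>
  The integral of the derivative of \<open>a\<^sup>2 g\<close> is zero, since by translation invariance this already holds for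
  its difference quotients. These satisfy a discrete product rule whose terms converge: one factor
  in \<open>L\<^sup>2\<close> because it is a difference quotient, the other because it is built from bounded translates.
\<close>
lemma integral_product_derivative:
  assumes a: "has_L2_derivative a a'" "\<And>x. \<bar>a x\<bar> \<le> A" and g: "has_L2_derivative g g'" "\<And>x. \<bar>g x\<bar> \<le> G"
  shows "2 * (\<integral>x. a' x * (a x * g x) \<partial>lborel) + (\<integral>x. (a x)\<^sup>2 * g' x \<partial>lborel) = 0"
proof -
  note aL2 = has_L2_derivativeD(1)[OF a(1)] and a'L2 = has_L2_derivativeD(2)[OF a(1)]
    and gL2 = has_L2_derivativeD(1)[OF g(1)] and g'L2 = has_L2_derivativeD(2)[OF g(1)]
  note [measurable] = L2_measurable[OF aL2] L2_measurable[OF gL2]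
  have A: "A \<ge> 0" and G: "G \<ge> 0" using a(2)[of 0] g(2)[of 0] by auto
  have a2: "(\<lambda>x. (a x)\<^sup>2) \<in> L2"
    using L2_mult_bounded[OF aL2 L2_measurable[OF aL2] a(2)] by (simp add: power2_eq_square)
  have ag: "(\<lambda>x. 2 * a x * g x) \<in> L2"
    using L2_cmult[OF L2_mult_bounded[OF gL2 L2_measurable[OF aL2] a(2)], of 2] by (simp add: mult_ac)
  have sum_meas: "(\<lambda>x. a (x + s) + a x) \<in> borel_measurable borel" and sum_bd: "\<bar>a (x + s) + a x\<bar> \<le> 2 * A" for s x
    using a(2)[of "x + s"] a(2)[of x] by (auto intro: order_trans[OF abs_triangle_ineq])
  have m: "(\<lambda>x. (a (x + s) + a x) * g (x + s)) \<in> L2" for s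
    by (rule L2_mult_bounded[OF L2_shift[OF gL2] sum_meas sum_bd])
  have "L2_lim (\<lambda>s x. (a (x + s) + a x) * g (x + s)) (\<lambda>x. 2 * a x * g x) (at_right 0)"
  proof (rule Lim_null_comparison)
    show "((\<lambda>s. 2 * A * L2_norm (\<lambda>x. g (x + s) - g x) + G * L2_norm (\<lambda>x. a (x + s) - a x)) \<longlongrightarrow> 0) (at_right 0)"
      using shift_tendsto[OF a(1)] shift_tendsto[OF g(1)] by (auto intro!: tendsto_eq_intros)
    show "\<forall>\<^sub>F s in at_right 0. norm (L2_norm (\<lambda>x. (a (x + s) + a x) * g (x + s) - 2 * a x * g x))
        \<le> 2 * A * L2_norm (\<lambda>x. g (x + s) - g x) + G * L2_norm (\<lambda>x. a (x + s) - a x)"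
    proof (rule always_eventually, rule allI)
      fix s
      have dL2: "(\<lambda>x. g (x + s) - g x) \<in> L2" "(\<lambda>x. a (x + s) - a x) \<in> L2"
        using aL2 gL2 by (auto intro: L2_diff L2_shift)
      have "L2_norm (\<lambda>x. (a (x + s) + a x) * g (x + s) - 2 * a x * g x)
          = L2_norm (\<lambda>x. (a (x + s) + a x) * (g (x + s) - g x) + g x * (a (x + s) - a x))"
        by (intro arg_cong[where f=L2_norm] ext) (simp add: algebra_simps)
      also have "\<dots> \<le> L2_norm (\<lambda>x. (a (x + s) + a x) * (g (x + s) - g x)) + L2_norm (\<lambda>x. g x * (a (x + s) - a x))"
        by (intro L2_norm_add L2_mult_bounded[OF _ sum_meas sum_bd] L2_mult_bounded[OF _ L2_measurable[OF gL2] g(2)] dL2)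
      also have "\<dots> \<le> 2 * A * L2_norm (\<lambda>x. g (x + s) - g x) + G * L2_norm (\<lambda>x. a (x + s) - a x)"
        by (intro add_mono L2_norm_mult_bounded[OF _ sum_meas sum_bd] L2_norm_mult_bounded[OF _ L2_measurable[OF gL2] g(2)] dL2)
      finally show "norm (L2_norm (\<lambda>x. (a (x + s) + a x) * g (x + s) - 2 * a x * g x))
        \<le> 2 * A * L2_norm (\<lambda>x. g (x + s) - g x) + G * L2_norm (\<lambda>x. a (x + s) - a x)" by simp
    qed
  qed
  then have "((\<lambda>s. \<integral>x. diff_quot s a x * ((a (x + s) + a x) * g (x + s)) \<partial>lborel)
       \<longlongrightarrow> (\<integral>x. a' x * (2 * a x * g x) \<partial>lborel)) (at_right 0)"
    by (intro L2_lim_inner diff_quot_tendsto a a'L2 ag always_eventually allI diff_quot_L2 aL2 m)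
  moreover have "((\<lambda>s. \<integral>x. (a x)\<^sup>2 * diff_quot s g x \<partial>lborel) \<longlongrightarrow> (\<integral>x. (a x)\<^sup>2 * g' x \<partial>lborel)) (at_right 0)"
  proof (rule L2_lim_inner[OF _ _ a2 g'L2 _ diff_quot_tendsto[OF g(1)]])
    show "L2_lim (\<lambda>s x. (a x)\<^sup>2) (\<lambda>x. (a x)\<^sup>2) (at_right 0)" by (simp add: L2_norm_def)
  qed (simp_all add: a2 diff_quot_L2 gL2)
  ultimately have lim: "((\<lambda>s. (\<integral>x. diff_quot s a x * ((a (x + s) + a x) * g (x + s)) \<partial>lborel) + (\<integral>x. (a x)\<^sup>2 * diff_quot s g x \<partial>lborel))
     \<longlongrightarrow> (\<integral>x. a' x * (2 * a x * g x) \<partial>lborel) + (\<integral>x. (a x)\<^sup>2 * g' x \<partial>lborel)) (at_right 0)"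
    by (rule tendsto_add)
  have zero: "(\<integral>x. diff_quot s a x * ((a (x + s) + a x) * g (x + s)) \<partial>lborel) + (\<integral>x. (a x)\<^sup>2 * diff_quot s g x \<partial>lborel) = 0" for s
  proof -
    have P: "integrable lborel (\<lambda>x. (a x)\<^sup>2 * g x)" by (rule L2_mult_integrable[OF a2 gL2])
    have "(\<integral>x. diff_quot s a x * ((a (x + s) + a x) * g (x + s)) \<partial>lborel) + (\<integral>x. (a x)\<^sup>2 * diff_quot s g x \<partial>lborel)
      = (\<integral>x. diff_quot s a x * ((a (x + s) + a x) * g (x + s)) + (a x)\<^sup>2 * diff_quot s g x \<partial>lborel)"
      by (intro Bochner_Integration.integral_add[symmetric] L2_mult_integrable diff_quot_L2 aL2 gL2 m a2)
    also have "\<dots> = (\<integral>x. ((a (x + s))\<^sup>2 * g (x + s) - (a x)\<^sup>2 * g x) / s \<partial>lborel)"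
      by (intro Bochner_Integration.integral_cong refl)
        (simp add: add_divide_distrib[symmetric] power2_eq_square algebra_simps)
    also have "\<dots> = 0"
      using P integrable_shift[OF P, of s] integral_shift[of "\<lambda>x. (a x)\<^sup>2 * g x" s] by simp
    finally show ?thesis .
  qed
  have "(\<integral>x. a' x * (2 * a x * g x) \<partial>lborel) + (\<integral>x. (a x)\<^sup>2 * g' x \<partial>lborel) = 0"
    using lim unfolding zero by (simp add: tendsto_const_iff)
  moreover have "(\<integral>x. a' x * (2 * a x * g x) \<partial>lborel) = 2 * (\<integral>x. a' x * (a x * g x) \<partial>lborel)"
    by (simp add: mult_ac flip: integral_mult_right_zero)
  ultimately show ?thesis by simp
qed

section \<open>The nonlocal operator\<close>

lemma has_bochner_integral_exp_abs: "has_bochner_integral lborel (\<lambda>x::real. exp (- \<bar>x\<bar>)) 2"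
proof -
  have "(\<integral>\<^sup>+x. ennreal (exp (- x)) * indicator {0..} x \<partial>lborel) = ennreal (0 - (- exp (- 0 :: real)))"
  proof (rule nn_integral_FTC_atLeast)
    show "((\<lambda>x::real. - exp (- x)) \<longlongrightarrow> 0) at_top" by real_asymp
  qed (auto intro!: derivative_eq_intros)
  moreover have "(\<integral>\<^sup>+x. ennreal (exp (- x)) * indicator {0..} x \<partial>lborel)
      = (\<integral>\<^sup>+x. ennreal (indicator {0..} x *\<^sub>R exp (- \<bar>x :: real\<bar>)) \<partial>lborel)"
    by (intro nn_integral_cong) (auto simp: indicator_def)
  ultimately have "(\<integral>\<^sup>+x. ennreal (indicator {0..} x *\<^sub>R exp (- \<bar>x :: real\<bar>)) \<partial>lborel) = ennreal 1"
    by simp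
  then have "has_bochner_integral lborel (\<lambda>x::real. indicator {0..} x *\<^sub>R exp (- \<bar>x\<bar>)) 1"
    by (intro has_bochner_integral_nn_integral) auto
  from has_bochner_integral_even_function[OF this] show ?thesis by simp
qed

definition Helmholtz_kernel :: "real \<Rightarrow> real" where
  "Helmholtz_kernel x = - (1/2) * sgn x * exp (- \<bar>x\<bar>)"

lemma Helmholtz_kernel_measurable [measurable]: "Helmholtz_kernel \<in> borel_measurable borel"
  unfolding Helmholtz_kernel_def by measurable

lemma Helmholtz_kernel_bound: "\<bar>Helmholtz_kernel x\<bar> \<le> exp (- \<bar>x\<bar>) / 2"
  by (simp add: Helmholtz_kernel_def abs_mult sgn_if)

lemma dx_inv_Helmholtz_alt:
  "dx_inv_Helmholtz f (x + h) = (\<integral>r. Helmholtz_kernel (h - r) * f (x + r) \<partial>lborel)"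
proof -
  have "dx_inv_Helmholtz f (x + h) = (\<integral>y. Helmholtz_kernel (x + h - y) * f y \<partial>lborel)"
    by (simp add: dx_inv_Helmholtz_def convolve_def Helmholtz_kernel_def)
  also have "\<dots> = (\<integral>r. Helmholtz_kernel (x + h - (r + x)) * f (r + x) \<partial>lborel)"
    by (rule integral_shift[symmetric])
  finally show ?thesis by (simp add: algebra_simps)
qed

lemma integrable_Helmholtz_kernel_mult:
  fixes f :: "real \<Rightarrow> real"
  assumes "integrable lborel f"
  shows "integrable lborel (\<lambda>r. Helmholtz_kernel (h - r) * f (x + r))"
proof (rule Bochner_Integration.integrable_bound)
  show i: "integrable lborel (\<lambda>r. f (x + r))" using integrable_shift[OF assms, of x] by (simp add: add.commute)
  show "(\<lambda>r. Helmholtz_kernel (h - r) * f (x + r)) \<in> borel_measurable lborel"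
    using borel_measurable_integrable[OF i] by simp
  show "AE r in lborel. norm (Helmholtz_kernel (h - r) * f (x + r)) \<le> norm (f (x + r))"
  proof (rule AE_I2)
    fix r
    have "exp (- \<bar>h - r\<bar>) \<le> 1" by simp
    then have "\<bar>Helmholtz_kernel (h - r)\<bar> \<le> 1" using Helmholtz_kernel_bound[of "h - r"] by linarith
    then show "norm (Helmholtz_kernel (h - r) * f (x + r)) \<le> norm (f (x + r))"
      by (simp add: abs_mult mult_left_le_one_le)
  qed
qed

lemma dx_inv_Helmholtz_L1:
  assumes f: "integrable lborel f"
  shows "integrable lborel (dx_inv_Helmholtz f)"
    and "(\<integral>x. \<bar>dx_inv_Helmholtz f x\<bar> \<partial>lborel) \<le> (\<integral>x. \<bar>f x\<bar> \<partial>lborel)"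
proof -
  let ?K = "\<lambda>r. Helmholtz_kernel (0 - r)"
  have e: "integrable lborel (\<lambda>r::real. exp (- \<bar>r\<bar>))" "(\<integral>r. exp (- \<bar>r :: real\<bar>) \<partial>lborel) = 2"
    using has_bochner_integral_exp_abs by (auto simp: has_bochner_integral_iff)
  have bd: "\<bar>?K r\<bar> \<le> exp (- \<bar>r\<bar>) / 2" for r using Helmholtz_kernel_bound[of "- r"] by simp
  have K: "integrable lborel ?K"
    by (rule Bochner_Integration.integrable_bound[of _ "\<lambda>r. exp (- \<bar>r\<bar>) / 2"]) (use e bd in auto)
  have "(\<integral>r. \<bar>?K r\<bar> \<partial>lborel) \<le> (\<integral>r. exp (- \<bar>r\<bar>) / 2 \<partial>lborel)"
    by (intro integral_mono integrable_abs K bd) (use e in auto)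
  then have K1: "(\<integral>r. \<bar>?K r\<bar> \<partial>lborel) \<le> 1" using e by simp
  have eq: "dx_inv_Helmholtz f = (\<lambda>x. \<integral>r. ?K r * f (x + r) \<partial>lborel)"
    using dx_inv_Helmholtz_alt[of f _ 0] by auto
  show "integrable lborel (dx_inv_Helmholtz f)" unfolding eq by (rule correlation(1)[OF K f])
  have "(\<integral>x. \<bar>dx_inv_Helmholtz f x\<bar> \<partial>lborel) \<le> (\<integral>r. \<bar>?K r\<bar> \<partial>lborel) * (\<integral>x. \<bar>f x\<bar> \<partial>lborel)"
    unfolding eq by (rule correlation_abs[OF K f])
  also have "\<dots> \<le> 1 * (\<integral>x. \<bar>f x\<bar> \<partial>lborel)" by (intro mult_right_mono K1) simp
  finally show "(\<integral>x. \<bar>dx_inv_Helmholtz f x\<bar> \<partial>lborel) \<le> (\<integral>x. \<bar>f x\<bar> \<partial>lborel)" by simp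
qed

text \<open>
  Away from the jump at 0 the kernel is Lipschitz with an exponentially decaying constant; the jump
  affects only the points \<open>r \<in> [0, h]\<close>, where \<open>h - r\<close> and \<open>- r\<close> lie on different sides of it.
\<close>
lemma Helmholtz_kernel_increment:
  assumes "0 < h" "h \<le> 1"
  shows "\<bar>Helmholtz_kernel (h - r) - Helmholtz_kernel (0 - r)\<bar> \<le> h * exp (- \<bar>r\<bar>) + indicator {0..h} r"
proof -
  have eh: "exp h - 1 \<le> 2 * h"
  proof -
    have "exp h \<le> 1 + h + h\<^sup>2" using assms by (intro exp_bound) auto
    moreover have "h\<^sup>2 \<le> h" using assms by (simp add: power2_eq_square mult_left_le)
    ultimately show ?thesis by linarith
  qed
  have emh: "1 - exp (- h) \<le> h" using exp_ge_add_one_self[of "- h"] by linarith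
  consider "r > h" | "r < 0" | "r \<in> {0..h}" by fastforce
  then show ?thesis
  proof cases
    case 1
    have "Helmholtz_kernel (h - r) - Helmholtz_kernel (0 - r) = exp (- r) * (exp h - 1) / 2"
      using 1 assms by (simp add: Helmholtz_kernel_def exp_add[symmetric] algebra_simps diff_divide_distrib)
    moreover have "0 \<le> exp (- r) * (exp h - 1)" using assms by simp
    moreover have "exp (- r) * (exp h - 1) \<le> exp (- r) * (2 * h)" by (intro mult_left_mono eh) simp
    moreover have "h * exp (- \<bar>r\<bar>) + indicator {0..h} r = exp (- r) * (2 * h) / 2" using 1 assms by simp
    ultimately show ?thesis by linarith
  next
    case 2
    have "Helmholtz_kernel (h - r) - Helmholtz_kernel (0 - r) = exp r * (1 - exp (- h)) / 2"
      using 2 assms by (simp add: Helmholtz_kernel_def exp_add[symmetric] algebra_simps diff_divide_distrib)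
    moreover have "0 \<le> exp r * (1 - exp (- h))" using assms by simp
    moreover have "exp r * (1 - exp (- h)) \<le> exp r * h" by (intro mult_left_mono emh) simp
    moreover have "h * exp (- \<bar>r\<bar>) + indicator {0..h} r = exp r * h" using 2 assms by simp
    ultimately show ?thesis by linarith
  next
    case 3
    have "exp (- \<bar>h - r\<bar>) \<le> 1" "exp (- \<bar>0 - r\<bar>) \<le> 1" by simp_all
    then have "\<bar>Helmholtz_kernel (h - r) - Helmholtz_kernel (0 - r)\<bar> \<le> 1"
      using Helmholtz_kernel_bound[of "h - r"] Helmholtz_kernel_bound[of "0 - r"] by linarith
    then show ?thesis using 3 assms by (simp add: add_increasing)
  qed
qed

text \<open>
  The jump of the kernel costs only \<open>h\<close> in \<open>L\<^sup>1\<close>, so the increment is of order \<open>h\<close> there and the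
  quotient stays bounded as \<open>h\<close> tends to 0.
\<close>
lemma diff_quot_dx_inv_Helmholtz_L1:
  assumes f: "integrable lborel f" and h: "0 < h" "h \<le> 1"
  shows "(\<integral>x. \<bar>diff_quot h (dx_inv_Helmholtz f) x\<bar> \<partial>lborel) \<le> 3 * (\<integral>x. \<bar>f x\<bar> \<partial>lborel)"
proof -
  let ?K = "\<lambda>r. Helmholtz_kernel (h - r) - Helmholtz_kernel (0 - r)"
  have e: "integrable lborel (\<lambda>r::real. exp (- \<bar>r\<bar>))" "(\<integral>r. exp (- \<bar>r :: real\<bar>) \<partial>lborel) = 2"
    using has_bochner_integral_exp_abs by (auto simp: has_bochner_integral_iff)
  have I: "integrable lborel (indicator {0..h} :: real \<Rightarrow> real)"
    using h by (intro integrable_real_indicator) auto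
  have dom: "integrable lborel (\<lambda>r. h * exp (- \<bar>r\<bar>) + indicator {0..h} r)" using e I by simp
  have "AE r in lborel. norm (?K r) \<le> norm (h * exp (- \<bar>r\<bar>) + indicator {0..h} r)"
    using Helmholtz_kernel_increment[OF h] by (auto intro!: AE_I2 order_trans[OF _ abs_ge_self])
  then have K: "integrable lborel ?K"
    by (intro Bochner_Integration.integrable_bound[OF dom]) auto
  have "(\<integral>r. \<bar>?K r\<bar> \<partial>lborel) \<le> (\<integral>r. h * exp (- \<bar>r\<bar>) + indicator {0..h} r \<partial>lborel)"
    by (intro integral_mono integrable_abs K dom Helmholtz_kernel_increment h)
  also have "\<dots> = 3 * h" using e I h by simp
  finally have K1: "(\<integral>r. \<bar>?K r\<bar> \<partial>lborel) \<le> 3 * h" .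
  have eq: "diff_quot h (dx_inv_Helmholtz f) x = (\<integral>r. ?K r * f (x + r) \<partial>lborel) / h" for x
    using dx_inv_Helmholtz_alt[of f x h] dx_inv_Helmholtz_alt[of f x 0]
      integrable_Helmholtz_kernel_mult[OF f, of h x] integrable_Helmholtz_kernel_mult[OF f, of 0 x]
    by (simp add: left_diff_distrib)
  have "(\<integral>x. \<bar>diff_quot h (dx_inv_Helmholtz f) x\<bar> \<partial>lborel) = (\<integral>x. \<bar>\<integral>r. ?K r * f (x + r) \<partial>lborel\<bar> \<partial>lborel) / h"
    unfolding eq using h by (simp add: abs_divide)
  also have "\<dots> \<le> (3 * h) * (\<integral>x. \<bar>f x\<bar> \<partial>lborel) / h"
    by (intro divide_right_mono order_trans[OF correlation_abs[OF K f]] mult_right_mono K1) (use h in auto)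
  finally show ?thesis using h by simp
qed

lemma AE_lborel_witness:
  assumes "AE s in lborel. P (s :: real)" "a < b"
  obtains s where "s \<in> {a<..<b}" "P s"
proof (rule ccontr)
  assume "\<not> thesis"
  then have "AE s in lborel. s \<notin> {a<..<b}" using assms(1) that by (auto elim: eventually_mono)
  then have "{a<..<b} \<in> null_sets lborel" using AE_iff_null_sets[of "{a<..<b}" lborel] by simp
  then show False using assms(2) by (simp add: null_sets_def)
qed

text \<open>
  For \<open>p < q\<close> the map \<open>y \<mapsto> k (q - y) - k (p - y)\<close> is strictly positive off \<open>[p, q]\<close>: on either side
  the kernel is evaluated on a half-line on which it is increasing. A nonnegative \<open>f\<close> that lives off
  \<open>[p, q]\<close> and has equal images at \<open>p\<close> and \<open>q\<close> must therefore be zero.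
\<close>
lemma dx_inv_Helmholtz_unique_continuation:
  assumes f: "integrable lborel f" "\<And>x. 0 \<le> f x" and ac: "a < c"
    and f0: "AE x in lborel. x \<in> {a<..<c} \<longrightarrow> f x = 0"
    and F0: "AE x in lborel. x \<in> {a<..<c} \<longrightarrow> dx_inv_Helmholtz f x = 0"
  shows "AE x in lborel. f x = 0"
proof -
  \<comment> \<open>The image vanishes only almost everywhere; two separate halves supply points \<open>p < q\<close> where it does.\<close>
  obtain p where p: "p \<in> {a<..<(a + c) / 2}" "p \<in> {a<..<c} \<longrightarrow> dx_inv_Helmholtz f p = 0"
    by (rule AE_lborel_witness[OF F0, of a "(a + c) / 2"]) (use ac in auto)
  obtain q where q: "q \<in> {(a + c) / 2<..<c}" "q \<in> {a<..<c} \<longrightarrow> dx_inv_Helmholtz f q = 0"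
    by (rule AE_lborel_witness[OF F0, of "(a + c) / 2" c]) (use ac in auto)
  have pq: "a < p" "p < q" "q < c" "dx_inv_Helmholtz f p = 0" "dx_inv_Helmholtz f q = 0"
    using p q ac by auto
  let ?k = "\<lambda>y. Helmholtz_kernel (q - y) - Helmholtz_kernel (p - y)"
  have pos: "?k y > 0" if "y < p \<or> y > q" for y
    using that pq(2) by (auto simp: Helmholtz_kernel_def)
  note i = integrable_Helmholtz_kernel_mult[OF f(1), of q 0] integrable_Helmholtz_kernel_mult[OF f(1), of p 0]
  have int: "integrable lborel (\<lambda>y. ?k y * f y)"
    using Bochner_Integration.integrable_diff[OF i] by (simp add: left_diff_distrib)
  have "(\<integral>y. ?k y * f y \<partial>lborel) = dx_inv_Helmholtz f (0 + q) - dx_inv_Helmholtz f (0 + p)"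
    unfolding dx_inv_Helmholtz_alt using i by (simp add: left_diff_distrib)
  then have zero: "(\<integral>y. ?k y * f y \<partial>lborel) = 0" using pq by simp
  have outside: "f y = 0 \<or> ?k y > 0" if "y \<in> {a<..<c} \<longrightarrow> f y = 0" for y
    using that pos[of y] pq by fastforce
  have "AE y in lborel. 0 \<le> ?k y * f y"
    using f0
  proof eventually_elim
    case (elim y)
    show ?case using outside[OF elim] f(2)[of y] by auto
  qed
  then have "AE y in lborel. ?k y * f y = 0"
    using integral_nonneg_eq_0_iff_AE[OF int] zero by simp
  then show ?thesis using f0
  proof eventually_elim
    case (elim y)
    then show ?case using outside[OF elim(2)] by auto
  qed
qed

section \<open>The energy inequality\<close>

lemma AE_lborel_shift:
  assumes "AE x in lborel. P (x :: real)"
  shows "AE x in lborel. P (x + h)"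
proof -
  have "AE x in distr lborel borel ((+) h). P x" unfolding lborel_distr_plus by (rule assms)
  from AE_distrD[OF _ this] show ?thesis by (simp add: add.commute)
qed

lemma integral_bounded_mult:
  fixes f g :: "real \<Rightarrow> real"
  assumes f: "f \<in> borel_measurable borel" "\<And>x. \<bar>f x\<bar> \<le> M" and g: "integrable lborel g"
  shows "integrable lborel (\<lambda>x. f x * g x)" "\<bar>\<integral>x. f x * g x \<partial>lborel\<bar> \<le> M * (\<integral>x. \<bar>g x\<bar> \<partial>lborel)"
proof -
  have bd: "\<bar>f x * g x\<bar> \<le> M * \<bar>g x\<bar>" for x unfolding abs_mult by (rule mult_right_mono[OF f(2)]) simp
  have i: "integrable lborel (\<lambda>x. M * \<bar>g x\<bar>)" using g by simp
  show fg: "integrable lborel (\<lambda>x. f x * g x)"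
  proof (rule Bochner_Integration.integrable_bound[OF i])
    show "(\<lambda>x. f x * g x) \<in> borel_measurable lborel" using f(1) borel_measurable_integrable[OF g] by simp
    show "AE x in lborel. norm (f x * g x) \<le> norm (M * \<bar>g x\<bar>)"
      using bd by (auto intro!: AE_I2 order_trans[OF bd])
  qed
  have "\<bar>\<integral>x. f x * g x \<partial>lborel\<bar> \<le> (\<integral>x. \<bar>f x * g x\<bar> \<partial>lborel)" by (rule integral_abs_bound)
  also have "\<dots> \<le> (\<integral>x. M * \<bar>g x\<bar> \<partial>lborel)" by (intro integral_mono integrable_abs fg i bd)
  finally show "\<bar>\<integral>x. f x * g x \<partial>lborel\<bar> \<le> M * (\<integral>x. \<bar>g x\<bar> \<partial>lborel)" by simp
qed

text \<open>
  This is the time derivative of the discrete energy of a solution with time derivative \<open>v\<close>, see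
  \<open>has_real_derivative_L2_energy\<close>. Insert the equation for \<open>v\<close> and write \<open>D = D\<^sub>h u\<close>. By the discrete
  product rule, \<open>D\<^sub>h (u w) = u (\<cdot> + h) D\<^sub>h w + w D\<close>. As \<open>D\<^sub>h w\<close> is the derivative of \<open>D\<close>, integration by
  parts turns \<open>\<integral>u (\<cdot> + h) D D\<^sub>h w\<close> into \<open>- \<integral>D\<^sup>2 w (\<cdot> + h) / 2\<close>. The remaining terms contain only \<open>u\<close>, \<open>w\<close>
  and \<open>D\<close>; bounding one factor \<open>u\<close> or \<open>D\<close> by \<open>M\<close> leaves two \<open>L\<^sup>2\<close> factors, or one \<open>L\<^sup>1\<close> factor for the
  nonlocal term. The constant is \<open>12 = 2 (3/2 + 9/2)\<close>.
\<close>
lemma energy_rate: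
  assumes uw: "has_L2_derivative u w" and v: "v \<in> L2"
    and bounded: "\<And>x. \<bar>u x\<bar> \<le> M" and lip: "\<And>x y. \<bar>u x - u y\<bar> \<le> M * \<bar>x - y\<bar>"
    and eq: "AE x in lborel. v x + u x * w x + dx_inv_Helmholtz (\<lambda>y. (u y)\<^sup>2 + 1/2 * (w y)\<^sup>2) x = 0"
    and h: "0 < h" "h \<le> 1"
  shows "\<bar>2 * (\<integral>x. u x * v x \<partial>lborel) + 2 * (\<integral>x. diff_quot h u x * diff_quot h v x \<partial>lborel)\<bar>
      \<le> 12 * M * ((\<integral>x. (u x)\<^sup>2 \<partial>lborel) + (\<integral>x. (w x)\<^sup>2 \<partial>lborel))"
proof -
  note uL2 = has_L2_derivativeD(1)[OF uw] and wL2 = has_L2_derivativeD(2)[OF uw]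
  note um = L2_measurable[OF uL2] and wm = L2_measurable[OF wL2] and vm = L2_measurable[OF v]
  note [measurable] = um wm vm
  define f where "f y = (u y)\<^sup>2 + 1/2 * (w y)\<^sup>2" for y
  define F where "F = dx_inv_Helmholtz f"
  define D where "D = diff_quot h u"
  define N where "N = (\<integral>x. (u x)\<^sup>2 \<partial>lborel) + (\<integral>x. (w x)\<^sup>2 \<partial>lborel)"
  have M: "M \<ge> 0" using bounded[of 0] by simp
  have sqi: "integrable lborel (\<lambda>x. (u x)\<^sup>2)" "integrable lborel (\<lambda>x. (w x)\<^sup>2)"
    using uL2 wL2 by (auto intro: L2_square_integrable)
  have fi: "integrable lborel f" unfolding f_def using sqi by simp
  have fN: "(\<integral>x. \<bar>f x\<bar> \<partial>lborel) \<le> N"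
  proof -
    have "(\<integral>x. \<bar>f x\<bar> \<partial>lborel) = (\<integral>x. (u x)\<^sup>2 \<partial>lborel) + 1/2 * (\<integral>x. (w x)\<^sup>2 \<partial>lborel)"
      using sqi by (simp add: f_def)
    then show ?thesis by (simp add: N_def)
  qed
  have Fi: "integrable lborel F" and F1: "(\<integral>x. \<bar>F x\<bar> \<partial>lborel) \<le> N"
    using dx_inv_Helmholtz_L1[OF fi] fN by (auto simp: F_def)
  have DFi: "integrable lborel (diff_quot h F)" using Fi integrable_shift[OF Fi, of h] by simp
  have DF1: "(\<integral>x. \<bar>diff_quot h F x\<bar> \<partial>lborel) \<le> 3 * N"
    using diff_quot_dx_inv_Helmholtz_L1[OF fi h] fN by (simp add: F_def)
  have DL2: "D \<in> L2" unfolding D_def by (rule diff_quot_L2[OF uL2])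
  note Dm [measurable] = L2_measurable[OF DL2]
  have Dbd: "\<bar>D x\<bar> \<le> M" for x using lip[of "x + h" x] h by (simp add: D_def field_simps)
  have DN: "L2_norm D \<le> L2_norm w" unfolding D_def by (rule L2_norm_diff_quot[OF uw h(1)])
  have uwL2: "(\<lambda>x. u x * w x) \<in> L2" by (rule L2_mult_bounded[OF wL2 um bounded])
  have DwL2: "(\<lambda>x. D x * w x) \<in> L2" by (rule L2_mult_bounded[OF wL2 Dm Dbd])
  have ww: "L2_norm w * L2_norm w \<le> N" "L2_norm u * L2_norm w \<le> N / 2"
  proof -
    have N_eq: "N = (L2_norm u)\<^sup>2 + (L2_norm w)\<^sup>2" by (simp add: N_def L2_norm_square)
    show "L2_norm w * L2_norm w \<le> N" by (simp add: N_eq power2_eq_square)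
    have "0 \<le> (L2_norm u - L2_norm w)\<^sup>2" by simp
    then show "L2_norm u * L2_norm w \<le> N / 2" by (simp add: N_eq power2_diff)
  qed
  have veq: "AE x in lborel. v x = - (u x * w x) - F x"
    using eq unfolding F_def f_def by eventually_elim simp
  have bound1: "\<bar>\<integral>x. u x * v x \<partial>lborel\<bar> \<le> 3/2 * (M * N)"
  proof -
    have i: "integrable lborel (\<lambda>x. u x * (u x * w x))" "integrable lborel (\<lambda>x. u x * F x)"
      by (rule L2_mult_integrable[OF uL2 uwL2]) (rule integral_bounded_mult(1)[OF um bounded Fi])
    have "AE x in lborel. u x * v x = - (u x * (u x * w x)) - u x * F x"
      using veq by eventually_elim (simp add: right_diff_distrib)
    then have "(\<integral>x. u x * v x \<partial>lborel) = (\<integral>x. - (u x * (u x * w x)) - u x * F x \<partial>lborel)"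
      using Fi by (intro integral_cong_AE) auto
    also have "\<dots> = - (\<integral>x. u x * (u x * w x) \<partial>lborel) - (\<integral>x. u x * F x \<partial>lborel)" using i by simp
    finally have "\<bar>\<integral>x. u x * v x \<partial>lborel\<bar> \<le> \<bar>\<integral>x. u x * (u x * w x) \<partial>lborel\<bar> + \<bar>\<integral>x. u x * F x \<partial>lborel\<bar>" by linarith
    moreover have "\<bar>\<integral>x. u x * (u x * w x) \<partial>lborel\<bar> \<le> M * (N / 2)"
    proof -
      have "\<bar>\<integral>x. u x * (u x * w x) \<partial>lborel\<bar> \<le> L2_norm u * L2_norm (\<lambda>x. u x * w x)"
        by (rule L2_Cauchy_Schwarz[OF uL2 uwL2])
      also have "\<dots> \<le> L2_norm u * (M * L2_norm w)"
        by (intro mult_left_mono L2_norm_mult_bounded wL2 um bounded) simp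
      also have "\<dots> \<le> M * (N / 2)" using mult_left_mono[OF ww(2) M] by (simp add: mult_ac)
      finally show ?thesis .
    qed
    moreover have "\<bar>\<integral>x. u x * F x \<partial>lborel\<bar> \<le> M * N"
      using integral_bounded_mult(2)[OF um bounded Fi] mult_left_mono[OF F1 M] by linarith
    ultimately show ?thesis by simp
  qed
  have bound2: "\<bar>\<integral>x. D x * diff_quot h v x \<partial>lborel\<bar> \<le> 9/2 * (M * N)"
  proof -
    define D' where "D' = diff_quot h w"
    have D': "has_L2_derivative D D'" unfolding D_def D'_def by (rule has_L2_derivative_diff_quot[OF uw])
    have uh: "has_L2_derivative (\<lambda>x. u (x + h)) (\<lambda>x. w (x + h))" by (rule has_L2_derivative_shift[OF uw])
    have DuL2: "(\<lambda>x. D x * u (x + h)) \<in> L2"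
      by (rule L2_mult_bounded[OF has_L2_derivativeD(1)[OF uh] Dm Dbd])
    have i: "integrable lborel (\<lambda>x. D' x * (D x * u (x + h)))" "integrable lborel (\<lambda>x. D x * (D x * w x))"
       "integrable lborel (\<lambda>x. D x * diff_quot h F x)"
      by (rule L2_mult_integrable[OF has_L2_derivativeD(2)[OF D'] DuL2] L2_mult_integrable[OF DL2 DwL2]
          integral_bounded_mult(1)[OF Dm Dbd DFi])+
    have dv: "AE x in lborel. D x * diff_quot h v x = - (D' x * (D x * u (x + h))) - D x * (D x * w x) - D x * diff_quot h F x"
      using veq AE_lborel_shift[OF veq, of h]
    proof eventually_elim
      case (elim x)
      have "diff_quot h v x = - (u (x + h) * w (x + h) - u x * w x) / h - diff_quot h F x"
        unfolding elim by (simp add: diff_divide_distrib add_divide_distrib)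
      also have "\<dots> = - (D' x * u (x + h)) - D x * w x - diff_quot h F x"
        using h by (simp add: D_def D'_def field_simps)
      finally have quot: "diff_quot h v x = - (D' x * u (x + h)) - D x * w x - diff_quot h F x" .
      have "a * (- (b * c) - d - e) = - (b * (a * c)) - a * d - a * e" for a b c d e :: real
        by (simp add: algebra_simps)
      then show ?case unfolding quot .
    qed
    have "(\<integral>x. D x * diff_quot h v x \<partial>lborel) = (\<integral>x. - (D' x * (D x * u (x + h))) - D x * (D x * w x) - D x * diff_quot h F x \<partial>lborel)"
      using dv i by (intro integral_cong_AE) auto
    also have "\<dots> = - (\<integral>x. D' x * (D x * u (x + h)) \<partial>lborel) - (\<integral>x. D x * (D x * w x) \<partial>lborel) - (\<integral>x. D x * diff_quot h F x \<partial>lborel)"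
      using i by simp
    finally have "\<bar>\<integral>x. D x * diff_quot h v x \<partial>lborel\<bar> \<le> \<bar>\<integral>x. D' x * (D x * u (x + h)) \<partial>lborel\<bar>
        + \<bar>\<integral>x. D x * (D x * w x) \<partial>lborel\<bar> + \<bar>\<integral>x. D x * diff_quot h F x \<partial>lborel\<bar>" by linarith
    moreover have "\<bar>\<integral>x. D' x * (D x * u (x + h)) \<partial>lborel\<bar> \<le> M * N / 2"
    proof -
      have DD: "(\<lambda>x. D x * D x) \<in> L2" by (rule L2_mult_bounded[OF DL2 Dm Dbd])
      have "2 * (\<integral>x. D' x * (D x * u (x + h)) \<partial>lborel) = - (\<integral>x. (D x)\<^sup>2 * w (x + h) \<partial>lborel)"
        using integral_product_derivative[OF D' Dbd uh, of M] bounded by simp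
      moreover have "\<bar>\<integral>x. (D x)\<^sup>2 * w (x + h) \<partial>lborel\<bar> \<le> M * N"
      proof -
        have "\<bar>\<integral>x. (D x)\<^sup>2 * w (x + h) \<partial>lborel\<bar> \<le> L2_norm (\<lambda>x. D x * D x) * L2_norm (\<lambda>x. w (x + h))"
          using L2_Cauchy_Schwarz[OF DD L2_shift[OF wL2, of h]] by (simp add: power2_eq_square)
        also have "\<dots> \<le> (M * L2_norm w) * L2_norm w"
          unfolding L2_norm_shift using M DN
          by (intro mult_right_mono order_trans[OF L2_norm_mult_bounded[OF DL2 Dm Dbd]] mult_left_mono) auto
        also have "\<dots> \<le> M * N" using mult_left_mono[OF ww(1) M] by (simp add: mult_ac)
        finally show ?thesis .
      qed
      ultimately show ?thesis by linarith
    qed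
    moreover have "\<bar>\<integral>x. D x * (D x * w x) \<partial>lborel\<bar> \<le> M * N"
    proof -
      have "\<bar>\<integral>x. D x * (D x * w x) \<partial>lborel\<bar> \<le> L2_norm D * L2_norm (\<lambda>x. D x * w x)"
        by (rule L2_Cauchy_Schwarz[OF DL2 DwL2])
      also have "\<dots> \<le> L2_norm w * (M * L2_norm w)"
        by (intro mult_mono DN L2_norm_mult_bounded wL2 Dm Dbd) auto
      also have "\<dots> \<le> M * N" using mult_left_mono[OF ww(1) M] by (simp add: mult_ac)
      finally show ?thesis .
    qed
    moreover have "\<bar>\<integral>x. D x * diff_quot h F x \<partial>lborel\<bar> \<le> 3 * (M * N)"
      using integral_bounded_mult(2)[OF Dm Dbd DFi] mult_left_mono[OF DF1 M] by linarith
    ultimately show ?thesis by linarith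
  qed
  show ?thesis
    using bound1 bound2 unfolding N_def[symmetric] D_def by linarith
qed

section \<open>Differentiating energies along curves\<close>

lemma has_curve_deriv_L2_lim:
  assumes d: "has_curve_deriv L2 L2_norm I u v t" and u: "\<And>s. s \<in> I \<Longrightarrow> u s \<in> L2" and t: "t \<in> I"
  shows "L2_lim (\<lambda>s x. (u s x - u t x) / (s - t)) v (at t within I)" and "L2_lim u (u t) (at t within I)"
proof -
  let ?Q = "\<lambda>s x. (u s x - u t x) / (s - t)"
  have v: "v \<in> L2" using d by (simp add: has_curve_deriv_def)
  show lim: "L2_lim ?Q v (at t within I)" using d by (simp add: has_curve_deriv_def)
  show "L2_lim u (u t) (at t within I)"
  proof (rule Lim_null_comparison)
    show "((\<lambda>s. \<bar>s - t\<bar> * (L2_norm (\<lambda>x. ?Q s x - v x) + L2_norm v)) \<longlongrightarrow> 0) (at t within I)"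
      using lim by (auto intro!: tendsto_eq_intros)
    have "\<forall>\<^sub>F s in at t within I. s \<noteq> t \<and> s \<in> I" by (simp add: eventually_at_filter)
    then show "\<forall>\<^sub>F s in at t within I. norm (L2_norm (\<lambda>x. u s x - u t x)) \<le> \<bar>s - t\<bar> * (L2_norm (\<lambda>x. ?Q s x - v x) + L2_norm v)"
    proof eventually_elim
      case (elim s)
      have Q: "?Q s \<in> L2" using u t elim by (intro L2_divide L2_diff) auto
      have "L2_norm (?Q s) \<le> L2_norm (\<lambda>x. ?Q s x - v x) + L2_norm v"
        using L2_norm_add[OF L2_diff[OF Q v] v] by simp
      moreover have "L2_norm (\<lambda>x. u s x - u t x) = \<bar>s - t\<bar> * L2_norm (?Q s)"
        using elim by (simp add: L2_norm_divide)
      ultimately show ?case by (simp add: mult_left_mono)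
    qed
  qed
qed

text \<open>
  \<open>u\<^sub>s\<^sup>2 - u\<^sub>t\<^sup>2 = (u\<^sub>s + u\<^sub>t) (u\<^sub>s - u\<^sub>t)\<close>, and the inner product is continuous on \<open>L\<^sup>2\<close>.
\<close>
lemma has_real_derivative_L2_energy:
  assumes d: "has_curve_deriv L2 L2_norm I u v t" and u: "\<And>s. s \<in> I \<Longrightarrow> u s \<in> L2" and t: "t \<in> I"
  shows "((\<lambda>s. \<integral>x. (u s x)\<^sup>2 \<partial>lborel) has_real_derivative 2 * (\<integral>x. u t x * v x \<partial>lborel)) (at t within I)"
proof -
  let ?Q = "\<lambda>s x. (u s x - u t x) / (s - t)"
  have v: "v \<in> L2" using d by (simp add: has_curve_deriv_def)
  note lim = has_curve_deriv_L2_lim[OF d u t]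
  have ev: "\<forall>\<^sub>F s in at t within I. s \<noteq> t \<and> s \<in> I" by (simp add: eventually_at_filter)
  have "((\<lambda>s. \<integral>x. (u s x + u t x) * ?Q s x \<partial>lborel) \<longlongrightarrow> (\<integral>x. (2 * u t x) * v x \<partial>lborel)) (at t within I)"
  proof (rule L2_lim_inner[OF _ _ _ v _ lim(1)])
    show "\<forall>\<^sub>F s in at t within I. (\<lambda>x. u s x + u t x) \<in> L2"
      using ev by eventually_elim (use u t in \<open>auto intro: L2_add\<close>)
    show "\<forall>\<^sub>F s in at t within I. ?Q s \<in> L2"
      using ev by eventually_elim (use u t in \<open>auto intro!: L2_divide L2_diff\<close>)
    show "(\<lambda>x. 2 * u t x) \<in> L2" using u t by (intro L2_cmult)
    show "L2_lim (\<lambda>s x. u s x + u t x) (\<lambda>x. 2 * u t x) (at t within I)"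
      using lim(2) by (simp add: algebra_simps)
  qed
  moreover have "\<forall>\<^sub>F s in at t within I. (\<integral>x. (u s x + u t x) * ?Q s x \<partial>lborel)
      = ((\<integral>x. (u s x)\<^sup>2 \<partial>lborel) - (\<integral>x. (u t x)\<^sup>2 \<partial>lborel)) / (s - t)"
    using ev
  proof eventually_elim
    case (elim s)
    have "(\<integral>x. (u s x + u t x) * ?Q s x \<partial>lborel) = (\<integral>x. ((u s x)\<^sup>2 - (u t x)\<^sup>2) / (s - t) \<partial>lborel)"
      by (intro Bochner_Integration.integral_cong) (auto simp: power2_eq_square algebra_simps)
    also have "\<dots> = ((\<integral>x. (u s x)\<^sup>2 \<partial>lborel) - (\<integral>x. (u t x)\<^sup>2 \<partial>lborel)) / (s - t)"
      using L2_square_integrable[OF u[of s]] L2_square_integrable[OF u[OF t]] elim by simp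
    finally show ?case .
  qed
  ultimately have "((\<lambda>s. ((\<integral>x. (u s x)\<^sup>2 \<partial>lborel) - (\<integral>x. (u t x)\<^sup>2 \<partial>lborel)) / (s - t))
      \<longlongrightarrow> (\<integral>x. (2 * u t x) * v x \<partial>lborel)) (at t within I)"
    by (rule Lim_transform_eventually)
  then show ?thesis by (simp add: has_field_derivative_iff mult.assoc)
qed

lemma L2_norm_diff_quot_le:
  assumes "f \<in> L2"
  shows "L2_norm (diff_quot h f) \<le> 2 / \<bar>h\<bar> * L2_norm f"
proof -
  have "L2_norm (\<lambda>x. f (x + h) - f x) \<le> L2_norm f + L2_norm f"
    using L2_norm_add[OF L2_shift[OF assms, of h] L2_cmult[OF assms, of "-1"]] L2_norm_cmult[of "-1" f]
    by (simp add: L2_norm_shift)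
  then have "L2_norm (\<lambda>x. f (x + h) - f x) / \<bar>h\<bar> \<le> (L2_norm f + L2_norm f) / \<bar>h\<bar>" by (rule divide_right_mono) simp
  then show ?thesis by (simp add: L2_norm_divide)
qed

lemma L2_lim_diff_quot:
  assumes "\<forall>\<^sub>F s in F. fs s \<in> L2" "f \<in> L2" "L2_lim fs f F"
  shows "L2_lim (\<lambda>s. diff_quot h (fs s)) (diff_quot h f) F"
proof (rule Lim_null_comparison)
  show "((\<lambda>s. 2 / \<bar>h\<bar> * L2_norm (\<lambda>x. fs s x - f x)) \<longlongrightarrow> 0) F"
    using assms(3) by (rule tendsto_mult_right_zero)
  show "\<forall>\<^sub>F s in F. norm (L2_norm (\<lambda>x. diff_quot h (fs s) x - diff_quot h f x)) \<le> 2 / \<bar>h\<bar> * L2_norm (\<lambda>x. fs s x - f x)"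
    using assms(1)
  proof eventually_elim
    case (elim s)
    have "(\<lambda>x. diff_quot h (fs s) x - diff_quot h f x) = diff_quot h (\<lambda>x. fs s x - f x)"
      by (auto simp: diff_divide_distrib)
    then show ?case using L2_norm_diff_quot_le[OF L2_diff[OF elim assms(2)], of h] by simp
  qed
qed

lemma has_curve_deriv_diff_quot:
  assumes d: "has_curve_deriv L2 L2_norm I u v t" and u: "\<And>s. s \<in> I \<Longrightarrow> u s \<in> L2" and t: "t \<in> I"
  shows "has_curve_deriv L2 L2_norm I (\<lambda>s. diff_quot h (u s)) (diff_quot h v) t"
proof -
  let ?Q = "\<lambda>s x. (u s x - u t x) / (s - t)"
  have v: "v \<in> L2" using d by (simp add: has_curve_deriv_def)
  have "\<forall>\<^sub>F s in at t within I. s \<noteq> t \<and> s \<in> I" by (simp add: eventually_at_filter)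
  then have "\<forall>\<^sub>F s in at t within I. ?Q s \<in> L2"
    by eventually_elim (use u t in \<open>auto intro!: L2_divide L2_diff\<close>)
  then have "L2_lim (\<lambda>s. diff_quot h (?Q s)) (diff_quot h v) (at t within I)"
    by (rule L2_lim_diff_quot[OF _ v has_curve_deriv_L2_lim(1)[OF d u t]])
  moreover have "diff_quot h (?Q s) x = (diff_quot h (u s) x - diff_quot h (u t) x) / (s - t)" for s x
    by (simp add: diff_divide_distrib[symmetric] algebra_simps)
  ultimately show ?thesis
    using diff_quot_L2[OF v, of h] by (simp add: has_curve_deriv_def)
qed

lemma L2_norm_square_tendsto:
  assumes "\<forall>\<^sub>F s in F. fs s \<in> L2" "f \<in> L2" "L2_lim fs f F"
  shows "((\<lambda>s. \<integral>x. (fs s x)\<^sup>2 \<partial>lborel) \<longlongrightarrow> (\<integral>x. (f x)\<^sup>2 \<partial>lborel)) F"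
  using L2_lim_inner[OF assms(1) assms(1) assms(2) assms(2) assms(3) assms(3)] by (simp add: power2_eq_square)

text \<open>
  Gronwall's inequality, forwards and backwards from \<open>t0\<close>, for a function \<open>N\<close> that is only bounded and
  is the supremum of differentiable functions \<open>q h\<close> with \<open>\<bar>q h'\<bar> \<le> C N\<close>. Let \<open>S\<close> be the supremum
  norm of \<open>N\<close> with weight \<open>exp (- K \<bar>t - t0\<bar>)\<close>. Integrating the differential inequality bounds
  each \<open>q h\<close>, hence \<open>N\<close>, by \<open>C / K * S\<close> in that norm; for \<open>K > 2 C\<close> this forces \<open>S = 0\<close>.
\<close>
lemma approximate_Gronwall:
  fixes N :: "real \<Rightarrow> real" and q :: "'i \<Rightarrow> real \<Rightarrow> real"
  assumes N: "\<And>t. t \<in> {0..T} \<Longrightarrow> 0 \<le> N t" "\<And>t. t \<in> {0..T} \<Longrightarrow> N t \<le> B"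
    and C: "C \<ge> 0"
    and q_cont: "\<And>h. h \<in> H \<Longrightarrow> continuous_on {0..T} (q h)"
    and q_deriv: "\<And>h t. h \<in> H \<Longrightarrow> t \<in> {0<..<T} \<Longrightarrow> \<exists>d. (q h has_real_derivative d) (at t) \<and> \<bar>d\<bar> \<le> C * N t"
    and q_le: "\<And>h t. h \<in> H \<Longrightarrow> t \<in> {0..T} \<Longrightarrow> q h t \<le> N t"
    and N_le: "\<And>t b. t \<in> {0..T} \<Longrightarrow> (\<And>h. h \<in> H \<Longrightarrow> q h t \<le> b) \<Longrightarrow> N t \<le> b"
    and t0: "t0 \<in> {0..T}" "N t0 = 0" and t: "t \<in> {0..T}"
  shows "N t = 0"
proof -
  define K where "K = 2 * C + 1"
  have K: "K > 0" using C by (simp add: K_def)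
  define W where "W t = exp (K * \<bar>t - t0\<bar>)" for t
  have W: "W t \<ge> 1" for t using K by (simp add: W_def)
  define S where "S = (SUP t\<in>{0..T}. N t / W t)"
  have bdd: "bdd_above ((\<lambda>t. N t / W t) ` {0..T})"
  proof (rule bdd_aboveI2)
    fix s assume s: "s \<in> {0..T}"
    have "N s / W s \<le> N s / 1" using N(1)[OF s] W[of s] by (intro divide_left_mono) auto
    then show "N s / W s \<le> B" using N(2)[OF s] by simp
  qed
  have N_W: "N s \<le> S * W s" if "s \<in> {0..T}" for s
  proof -
    have "N s / W s \<le> S" unfolding S_def by (rule cSUP_upper[OF that bdd])
    then show ?thesis using W[of s] by (simp add: divide_le_eq)
  qed
  have S: "S \<ge> 0" using N_W[OF t0(1)] t0(2) by (simp add: W_def)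
  have q_W: "q h s \<le> C / K * S * W s" if h: "h \<in> H" and s: "s \<in> {0..T}" for h s
  proof -
    have start: "q h t0 \<le> C / K * S * W t0"
    proof -
      have "0 \<le> C / K * S * W t0"
        using C K S W[of t0] by (intro mult_nonneg_nonneg divide_nonneg_pos) linarith+
      then show ?thesis using q_le[OF h t0(1)] t0(2) by linarith
    qed
    consider "s \<ge> t0" | "s < t0" by linarith
    then show ?thesis
    proof cases
      case 1
      have "q h s - C / K * S * exp (K * (s - t0)) \<le> q h t0 - C / K * S * exp (K * (t0 - t0))"
      proof (rule DERIV_nonpos_imp_decreasing_open[OF 1, where f="\<lambda>s. q h s - C / K * S * exp (K * (s - t0))"])
        fix r assume r: "t0 < r" "r < s"
        then have r': "r \<in> {0<..<T}" "r \<in> {0..T}" using t0 s by auto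
        obtain d where d: "(q h has_real_derivative d) (at r)" "\<bar>d\<bar> \<le> C * N r" using q_deriv[OF h r'(1)] by blast
        have "C * N r \<le> C * (S * W r)" by (intro mult_left_mono N_W r' C)
        then have "d - C / K * S * (exp (K * (r - t0)) * K) \<le> 0" using d(2) r K by (simp add: W_def)
        moreover have "((\<lambda>s. q h s - C / K * S * exp (K * (s - t0))) has_real_derivative d - C / K * S * (exp (K * (r - t0)) * K)) (at r)"
          by (auto intro!: derivative_eq_intros d(1))
        ultimately show "\<exists>y. ((\<lambda>s. q h s - C / K * S * exp (K * (s - t0))) has_real_derivative y) (at r) \<and> y \<le> 0" by blast
      next
        show "continuous_on {t0..s} (\<lambda>s. q h s - C / K * S * exp (K * (s - t0)))"
          using t0 s by (intro continuous_intros continuous_on_subset[OF q_cont[OF h]]) auto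
      qed
      then show ?thesis using start 1 by (simp add: W_def)
    next
      case 2
      then have 2: "s \<le> t0" by simp
      have "q h s - C / K * S * exp (K * (t0 - s)) \<le> q h t0 - C / K * S * exp (K * (t0 - t0))"
      proof (rule DERIV_nonneg_imp_increasing_open[OF 2, where f="\<lambda>s. q h s - C / K * S * exp (K * (t0 - s))"])
        fix r assume r: "s < r" "r < t0"
        then have r': "r \<in> {0<..<T}" "r \<in> {0..T}" using t0 s by auto
        obtain d where d: "(q h has_real_derivative d) (at r)" "\<bar>d\<bar> \<le> C * N r" using q_deriv[OF h r'(1)] by blast
        have "C * N r \<le> C * (S * W r)" by (intro mult_left_mono N_W r' C)
        then have "d - C / K * S * (exp (K * (t0 - r)) * (- K)) \<ge> 0" using d(2) r K by (simp add: W_def)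
        moreover have "((\<lambda>s. q h s - C / K * S * exp (K * (t0 - s))) has_real_derivative d - C / K * S * (exp (K * (t0 - r)) * (- K))) (at r)"
          by (auto intro!: derivative_eq_intros d(1))
        ultimately show "\<exists>y. ((\<lambda>s. q h s - C / K * S * exp (K * (t0 - s))) has_real_derivative y) (at r) \<and> y \<ge> 0" by blast
      next
        show "continuous_on {s..t0} (\<lambda>s. q h s - C / K * S * exp (K * (t0 - s)))"
          using t0 s by (intro continuous_intros continuous_on_subset[OF q_cont[OF h]]) auto
      qed
      then show ?thesis using start 2 by (simp add: W_def)
    qed
  qed
  have "S \<le> C / K * S"
    unfolding S_def
  proof (rule cSUP_least)
    show "{0..T} \<noteq> {}" using t by blast
    fix s assume s: "s \<in> {0..T}"
    have "N s \<le> C / K * S * W s" by (rule N_le[OF s]) (rule q_W[OF _ s])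
    then show "N s / W s \<le> C / K * (SUP t\<in>{0..T}. N t / W t)" using W[of s] unfolding S_def[symmetric] by (simp add: divide_le_eq)
  qed
  moreover have "C / K \<le> 1 / 2" using C by (simp add: K_def divide_simps)
  then have "C / K * S \<le> 1 / 2 * S" by (rule mult_right_mono[OF _ S])
  ultimately have "S = 0" using S by linarith
  then show ?thesis using N_W[OF t] N(1)[OF t] by simp
qed

section \<open>Solutions of the Camassa-Holm equation\<close>

text \<open>
  A number strictly above the infimum of the Lipschitz constants exceeds one of them, hence the added 1.
\<close>
lemma W1inf_norm_bound:
  assumes f: "f \<in> W1inf" "W1inf_norm f \<le> C"
  shows "\<bar>f x\<bar> \<le> \<bar>C\<bar> + 1" "\<bar>f x - f y\<bar> \<le> (\<bar>C\<bar> + 1) * \<bar>x - y\<bar>"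
proof -
  let ?L = "{L. L-lipschitz_on UNIV f}"
  have ne: "?L \<noteq> {}" and bd: "bounded (range f)" using f by (auto simp: W1inf_def)
  have L0: "L \<ge> 0" if "L \<in> ?L" for L using that lipschitz_on_nonneg by auto
  then have inf0: "Inf ?L \<ge> 0" using ne by (intro cInf_greatest) auto
  from bd obtain A where "\<And>x. \<bar>f x\<bar> \<le> A" unfolding bounded_iff by auto
  then have "bdd_above (range (\<lambda>x. \<bar>f x\<bar>))" by (rule bdd_aboveI2)
  then have sup: "\<bar>f x\<bar> \<le> (SUP x. \<bar>f x\<bar>)" for x by (intro cSUP_upper) auto
  then show "\<bar>f x\<bar> \<le> \<bar>C\<bar> + 1" using inf0 f(2) sup[of x] unfolding W1inf_norm_def by linarith
  have "Inf ?L < \<bar>C\<bar> + 1" using f(2) sup[of x] unfolding W1inf_norm_def by linarith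
  then obtain L where L: "L \<in> ?L" "L < \<bar>C\<bar> + 1" using cInf_lessD[OF ne] by blast
  have "\<bar>f x - f y\<bar> \<le> L * \<bar>x - y\<bar>" using L(1) by (auto dest: lipschitz_onD[of L UNIV f x y] simp: dist_real_def)
  also have "\<dots> \<le> (\<bar>C\<bar> + 1) * \<bar>x - y\<bar>" using L(2) by (intro mult_right_mono) auto
  finally show "\<bar>f x - f y\<bar> \<le> (\<bar>C\<bar> + 1) * \<bar>x - y\<bar>" .
qed

lemma H1_norm_dominates: "L2_norm f \<le> H1_norm f" "L2_norm (weak_deriv f) \<le> H1_norm f"
  unfolding H1_norm_def by (intro real_le_rsqrt; simp)+

definition CH_energy :: "(real \<Rightarrow> real \<Rightarrow> real) \<Rightarrow> real \<Rightarrow> real" where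
  "CH_energy u t = (\<integral>x. (u t x)\<^sup>2 \<partial>lborel) + (\<integral>x. (weak_deriv (u t) x)\<^sup>2 \<partial>lborel)"

text \<open>
  Unlike \<open>CH_energy\<close>, this is differentiable in time for a curve that is differentiable with values in
  \<open>L\<^sup>2\<close>, because difference quotients with fixed \<open>h\<close> are bounded operators on \<open>L\<^sup>2\<close>.
\<close>
definition CH_discrete_energy :: "(real \<Rightarrow> real \<Rightarrow> real) \<Rightarrow> real \<Rightarrow> real \<Rightarrow> real" where
  "CH_discrete_energy u h t = (\<integral>x. (u t x)\<^sup>2 \<partial>lborel) + (\<integral>x. (diff_quot h (u t) x)\<^sup>2 \<partial>lborel)"

lemma CH_energy_nonneg: "0 \<le> CH_energy u t"
  by (simp add: CH_energy_def)

context
  fixes T :: real and u0 :: "real \<Rightarrow> real" and u :: "real \<Rightarrow> real \<Rightarrow> real"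
  assumes T: "T > 0" and sol: "CH_solution T u0 u"
begin

lemma CH_H1: "t \<in> {0..T} \<Longrightarrow> u t \<in> H1" "t \<in> {0..T} \<Longrightarrow> continuous_on UNIV (u t)"
  using sol by (auto simp: CH_solution_def C0_curve_def)

lemma CH_has_L2_derivative: "t \<in> {0..T} \<Longrightarrow> has_L2_derivative (u t) (weak_deriv (u t))"
  by (intro H1_has_L2_derivative CH_H1)

lemmas CH_L2 = has_L2_derivativeD(1,2)[OF CH_has_L2_derivative]

lemma CH_H1_continuous: "t \<in> {0..T} \<Longrightarrow> ((\<lambda>s. H1_norm (\<lambda>x. u s x - u t x)) \<longlongrightarrow> 0) (at t within {0..T})"
  using sol by (auto simp: CH_solution_def C0_curve_def)

lemma eventually_in_interval: "\<forall>\<^sub>F s in at t within {0..T}. s \<in> {0..T}"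
  by (simp add: eventually_at_filter)

lemma CH_L2_continuous:
  assumes t: "t \<in> {0..T}"
  shows "L2_lim u (u t) (at t within {0..T})"
    and "L2_lim (\<lambda>s. weak_deriv (u s)) (weak_deriv (u t)) (at t within {0..T})"
proof -
  show "L2_lim u (u t) (at t within {0..T})"
    by (rule Lim_null_comparison[OF _ CH_H1_continuous[OF t]]) (simp add: H1_norm_dominates)
  show "L2_lim (\<lambda>s. weak_deriv (u s)) (weak_deriv (u t)) (at t within {0..T})"
  proof (rule Lim_null_comparison[OF _ CH_H1_continuous[OF t]])
    show "\<forall>\<^sub>F s in at t within {0..T}. norm (L2_norm (\<lambda>x. weak_deriv (u s) x - weak_deriv (u t) x)) \<le> H1_norm (\<lambda>x. u s x - u t x)"
      using eventually_in_interval
    proof eventually_elim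
      case (elim s)
      show ?case
        using H1_norm_dominates(2)[of "\<lambda>x. u s x - u t x"]
          L2_norm_weak_deriv_diff[OF CH_H1(1)[OF elim] CH_H1(1)[OF t] CH_H1(2)[OF elim] CH_H1(2)[OF t]] by simp
    qed
  qed
qed

lemma CH_energy_bounded: obtains B where "\<And>t. t \<in> {0..T} \<Longrightarrow> CH_energy u t \<le> B"
proof -
  have "continuous_on {0..T} (CH_energy u)"
    unfolding continuous_on CH_energy_def
  proof (intro ballI tendsto_add L2_norm_square_tendsto CH_L2_continuous CH_L2)
    show "\<forall>\<^sub>F s in at t within {0..T}. u s \<in> L2" "\<forall>\<^sub>F s in at t within {0..T}. weak_deriv (u s) \<in> L2" for t
      by (rule eventually_mono[OF eventually_in_interval], erule CH_L2)+
  qed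
  then have "bounded (CH_energy u ` {0..T})" by (intro compact_imp_bounded compact_continuous_image) auto
  then show thesis using that unfolding bounded_iff by (metis abs_le_D1 imageI real_norm_def)
qed

text \<open>
  The bound in \<open>W1inf\<close> is given for almost every time only. Continuity in \<open>H1\<close> and the Sobolev
  inequality make nearby good times approximate any given time uniformly in space, so the bound
  extends to every time.
\<close>
lemma CH_Lipschitz_bound:
  obtains M where "\<And>t x. t \<in> {0..T} \<Longrightarrow> \<bar>u t x\<bar> \<le> M" "\<And>t x y. t \<in> {0..T} \<Longrightarrow> \<bar>u t x - u t y\<bar> \<le> M * \<bar>x - y\<bar>"
proof -
  from sol obtain C where C: "AE t in lborel. t \<in> {0..T} \<longrightarrow> u t \<in> W1inf \<and> W1inf_norm (u t) \<le> C"
    by (auto simp: CH_solution_def Linf_curve_def)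
  define M where "M = \<bar>C\<bar> + 1"
  have approx: "\<exists>s\<in>{0..T}. (\<forall>x. \<bar>u s x\<bar> \<le> M) \<and> (\<forall>x y. \<bar>u s x - u s y\<bar> \<le> M * \<bar>x - y\<bar>) \<and> (\<forall>x. \<bar>u s x - u t x\<bar> \<le> \<epsilon>)"
    if t: "t \<in> {0..T}" and "\<epsilon> > 0" for t \<epsilon>
  proof -
    have "\<forall>\<^sub>F s in at t within {0..T}. H1_norm (\<lambda>x. u s x - u t x) < \<epsilon> / 2"
      by (rule order_tendstoD(2)[OF CH_H1_continuous[OF t]]) (use \<open>\<epsilon> > 0\<close> in simp)
    then obtain d where d: "d > 0" "\<And>s. s \<in> {0..T} \<Longrightarrow> s \<noteq> t \<Longrightarrow> dist s t < d \<Longrightarrow> H1_norm (\<lambda>x. u s x - u t x) < \<epsilon> / 2"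
      unfolding eventually_at by blast
    obtain a b where ab: "a < b" "{a<..<b} \<subseteq> {0..T} - {t}" "\<And>s. s \<in> {a<..<b} \<Longrightarrow> dist s t < d"
    proof (cases "t < T")
      case True
      then show thesis using t d(1) by (intro that[of t "min T (t + d)"]) (auto simp: dist_real_def)
    next
      case False
      then show thesis using t d(1) T by (intro that[of "max 0 (t - d)" t]) (auto simp: dist_real_def)
    qed
    obtain s where s: "s \<in> {a<..<b}" "s \<in> {0..T} \<longrightarrow> u s \<in> W1inf \<and> W1inf_norm (u s) \<le> C"
      by (rule AE_lborel_witness[OF C ab(1)])
    then have sT: "s \<in> {0..T}" "s \<noteq> t" and good: "u s \<in> W1inf" "W1inf_norm (u s) \<le> C" using ab(2) by auto
    have "\<bar>u s x - u t x\<bar> \<le> \<epsilon>" for x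
    proof -
      have "has_L2_derivative (\<lambda>x. u s x - u t x) (weak_deriv (\<lambda>x. u s x - u t x))"
        by (intro H1_has_L2_derivative H1_diff continuous_on_diff CH_H1 sT t)
      from Sobolev_pointwise[OF this, of x] show ?thesis
        using H1_norm_dominates[of "\<lambda>x. u s x - u t x"] d(2)[OF sT ab(3)[OF s(1)]] by linarith
    qed
    then show ?thesis using W1inf_norm_bound[OF good] sT(1) unfolding M_def by blast
  qed
  show thesis
  proof (rule that[of M])
    fix t x assume t: "t \<in> {0..T}"
    show "\<bar>u t x\<bar> \<le> M"
    proof (rule field_le_epsilon)
      fix \<epsilon> :: real assume "\<epsilon> > 0"
      from approx[OF t this] obtain s where "\<bar>u s x\<bar> \<le> M" "\<bar>u s x - u t x\<bar> \<le> \<epsilon>" by blast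
      then show "\<bar>u t x\<bar> \<le> M + \<epsilon>" by linarith
    qed
  next
    fix t x y assume t: "t \<in> {0..T}"
    show "\<bar>u t x - u t y\<bar> \<le> M * \<bar>x - y\<bar>"
    proof (rule field_le_epsilon)
      fix \<epsilon> :: real assume "\<epsilon> > 0"
      then have "\<epsilon> / 2 > 0" by simp
      from approx[OF t this] obtain s where "\<bar>u s x - u s y\<bar> \<le> M * \<bar>x - y\<bar>" "\<bar>u s x - u t x\<bar> \<le> \<epsilon> / 2" "\<bar>u s y - u t y\<bar> \<le> \<epsilon> / 2"
        by blast
      then show "\<bar>u t x - u t y\<bar> \<le> M * \<bar>x - y\<bar> + \<epsilon>" by linarith
    qed
  qed
qed

lemma CH_discrete_energy_le:
  assumes "t \<in> {0..T}" "h > 0"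
  shows "CH_discrete_energy u h t \<le> CH_energy u t"
  using power_mono[OF L2_norm_diff_quot[OF CH_has_L2_derivative[OF assms(1)] assms(2)], of 2]
  by (simp add: CH_discrete_energy_def CH_energy_def L2_norm_square)

lemma CH_energy_le:
  assumes t: "t \<in> {0..T}" and b: "\<And>h. h \<in> {0<..1} \<Longrightarrow> CH_discrete_energy u h t \<le> b"
  shows "CH_energy u t \<le> b"
proof (rule tendsto_upperbound)
  show "((\<lambda>h. CH_discrete_energy u h t) \<longlongrightarrow> CH_energy u t) (at_right 0)"
    unfolding CH_discrete_energy_def CH_energy_def
    by (intro tendsto_add tendsto_const L2_norm_square_tendsto diff_quot_tendsto[OF CH_has_L2_derivative[OF t]]
        CH_L2[OF t] always_eventually allI diff_quot_L2)
  have "\<forall>\<^sub>F h :: real in at_right 0. h \<in> {0<..<1}" by (rule eventually_at_right_real) simp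
  then show "\<forall>\<^sub>F h in at_right 0. CH_discrete_energy u h t \<le> b"
    by (rule eventually_mono) (auto intro: b)
qed simp

lemma CH_discrete_energy_continuous: "continuous_on {0..T} (CH_discrete_energy u h)"
  unfolding continuous_on CH_discrete_energy_def
proof (intro ballI tendsto_add L2_norm_square_tendsto L2_lim_diff_quot CH_L2_continuous CH_L2 diff_quot_L2)
  fix t
  show u: "\<forall>\<^sub>F s in at t within {0..T}. u s \<in> L2"
    by (rule eventually_mono[OF eventually_in_interval]) (rule CH_L2)
  show "\<forall>\<^sub>F s in at t within {0..T}. u s \<in> L2" by (rule u)
  show "\<forall>\<^sub>F s in at t within {0..T}. diff_quot h (u s) \<in> L2"
    using u by (rule eventually_mono) (rule diff_quot_L2)
qed

lemma CH_discrete_energy_deriv: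
  assumes M: "\<And>t x. t \<in> {0..T} \<Longrightarrow> \<bar>u t x\<bar> \<le> M" "\<And>t x y. t \<in> {0..T} \<Longrightarrow> \<bar>u t x - u t y\<bar> \<le> M * \<bar>x - y\<bar>"
    and t: "t \<in> {0<..<T}" and h: "h \<in> {0<..1}"
  shows "\<exists>d. (CH_discrete_energy u h has_real_derivative d) (at t) \<and> \<bar>d\<bar> \<le> 12 * M * CH_energy u t"
proof -
  have t': "t \<in> {0..T}" using t by auto
  have L2: "u s \<in> L2" if "s \<in> {0<..<T}" for s using that by (intro CH_L2) auto
  from sol t obtain v where v: "has_curve_deriv L2 L2_norm {0<..<T} u v t"
    and eq: "AE x in lborel. v x + u t x * weak_deriv (u t) x
             + dx_inv_Helmholtz (\<lambda>y. (u t y)\<^sup>2 + 1/2 * (weak_deriv (u t) y)\<^sup>2) x = 0"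
    unfolding CH_solution_def CH_equation_at_def by blast
  have vL2: "v \<in> L2" using v by (simp add: has_curve_deriv_def)
  have "(CH_discrete_energy u h has_real_derivative
      2 * (\<integral>x. u t x * v x \<partial>lborel) + 2 * (\<integral>x. diff_quot h (u t) x * diff_quot h v x \<partial>lborel)) (at t within {0<..<T})"
    unfolding CH_discrete_energy_def
    by (intro DERIV_add has_real_derivative_L2_energy[OF v L2 t]
        has_real_derivative_L2_energy[OF has_curve_deriv_diff_quot[OF v L2 t] diff_quot_L2[OF L2] t])
  then have "(CH_discrete_energy u h has_real_derivative
      2 * (\<integral>x. u t x * v x \<partial>lborel) + 2 * (\<integral>x. diff_quot h (u t) x * diff_quot h v x \<partial>lborel)) (at t)"
    using at_within_open[OF t open_greaterThanLessThan] by simp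
  moreover have "\<bar>2 * (\<integral>x. u t x * v x \<partial>lborel) + 2 * (\<integral>x. diff_quot h (u t) x * diff_quot h v x \<partial>lborel)\<bar> \<le> 12 * M * CH_energy u t"
    unfolding CH_energy_def
    by (rule energy_rate[OF CH_has_L2_derivative[OF t'] vL2 M(1)[OF t'] M(2)[OF t'] eq]) (use h in auto)
  ultimately show ?thesis by blast
qed

lemma CH_zero_propagates:
  assumes "t0 \<in> {0..T}" "CH_energy u t0 = 0" "t \<in> {0..T}"
  shows "u t x = 0"
proof -
  obtain M where M: "\<And>t x. t \<in> {0..T} \<Longrightarrow> \<bar>u t x\<bar> \<le> M" "\<And>t x y. t \<in> {0..T} \<Longrightarrow> \<bar>u t x - u t y\<bar> \<le> M * \<bar>x - y\<bar>"
    by (rule CH_Lipschitz_bound) blast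
  obtain B where B: "\<And>t. t \<in> {0..T} \<Longrightarrow> CH_energy u t \<le> B" by (rule CH_energy_bounded) blast
  have "M \<ge> 0" using M(1)[OF assms(1), of 0] by simp
  have "CH_energy u t = 0"
    by (rule approximate_Gronwall[where q = "CH_discrete_energy u" and H = "{0<..1}" and C = "12 * M" and B = B, OF _ B])
      (use assms \<open>M \<ge> 0\<close> in \<open>auto simp: CH_energy_nonneg intro: CH_discrete_energy_continuous CH_discrete_energy_deriv[OF M]
        CH_discrete_energy_le CH_energy_le\<close>)
  then have "(L2_norm (u t))\<^sup>2 + (L2_norm (weak_deriv (u t)))\<^sup>2 = 0" by (simp add: CH_energy_def L2_norm_square)
  then have "L2_norm (u t) = 0" "L2_norm (weak_deriv (u t)) = 0" by (auto simp: sum_power2_eq_zero_iff)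
  then show ?thesis using Sobolev_pointwise[OF CH_has_L2_derivative[OF assms(3)], of x] by simp
qed

text \<open>
  At time \<open>t\<close> the time derivative and the space derivative vanish almost everywhere on a slightly
  shorter interval: the difference quotients in \<open>x\<close> are formed to the right and must stay inside
  \<open>(a, b)\<close>. The equation then makes the nonlocal term vanish there too.
\<close>
lemma CH_zero_on_rectangle:
  assumes t: "t \<in> {0<..<T}" and ab: "a < b" and \<delta>: "\<delta> > 0"
    and zero: "\<And>s x. s \<in> {0..T} \<Longrightarrow> \<bar>s - t\<bar> < \<delta> \<Longrightarrow> x \<in> {a<..<b} \<Longrightarrow> u s x = 0"
  shows "CH_energy u t = 0"
proof -
  have t': "t \<in> {0..T}" using t by auto
  note ut = CH_L2(1)[OF t'] and wt = CH_L2(2)[OF t']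
  define w where "w = weak_deriv (u t)"
  define f where "f y = (u t y)\<^sup>2 + 1/2 * (w y)\<^sup>2" for y
  define c where "c = (a + b) / 2"
  have c: "a < c" "c < b" using ab by (auto simp: c_def)
  from sol t obtain v where v: "has_curve_deriv L2 L2_norm {0<..<T} u v t"
    and eq: "AE x in lborel. v x + u t x * w x + dx_inv_Helmholtz f x = 0"
    unfolding CH_solution_def CH_equation_at_def w_def f_def[abs_def] by blast
  have L2: "u s \<in> L2" if "s \<in> {0<..<T}" for s using that by (intro CH_L2) auto
  have v0: "AE x in lborel. x \<in> {a<..<c} \<longrightarrow> v x = 0"
  proof (rule L2_lim_zero_on[OF _ _ has_curve_deriv_L2_lim(1)[OF v L2 t]])
    have ev: "\<forall>\<^sub>F s in at t within {0<..<T}. s \<in> {0<..<T}" by (simp add: eventually_at_filter)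
    show "\<forall>\<^sub>F s in at t within {0<..<T}. (\<lambda>x. (u s x - u t x) / (s - t)) \<in> L2"
      using ev by eventually_elim (intro L2_divide L2_diff L2 t)
    have "\<forall>\<^sub>F s in at t within {0<..<T}. dist s t < \<delta>" using \<delta> unfolding eventually_at by blast
    then show "\<forall>\<^sub>F s in at t within {0<..<T}. \<forall>x\<in>{a<..<c}. (u s x - u t x) / (s - t) = 0"
      using ev
    proof eventually_elim
      case (elim s)
      show ?case
      proof
        fix x assume "x \<in> {a<..<c}"
        then have x: "x \<in> {a<..<b}" using c by simp
        have "u s x = 0" by (rule zero[OF _ _ x]) (use elim in \<open>auto simp: dist_real_def\<close>)
        moreover have "u t x = 0" by (rule zero[OF t' _ x]) (use \<delta> in simp)
        ultimately show "(u s x - u t x) / (s - t) = 0" by simp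
      qed
    qed
    show "at t within {0<..<T} \<noteq> bot" unfolding at_within_open[OF t open_greaterThanLessThan] by simp
    show "v \<in> L2" using v by (simp add: has_curve_deriv_def)
  qed auto
  have w0: "AE x in lborel. x \<in> {a<..<c} \<longrightarrow> w x = 0"
  proof (rule L2_lim_zero_on[OF _ _ diff_quot_tendsto[OF CH_has_L2_derivative[OF t', folded w_def]]])
    show "\<forall>\<^sub>F h in at_right 0. diff_quot h (u t) \<in> L2" by (intro always_eventually allI diff_quot_L2 ut)
    show "w \<in> L2" using wt by (simp add: w_def)
    have "\<forall>\<^sub>F h in at_right 0. h \<in> {0<..<b - c}" using c by (intro eventually_at_right_real) simp
    then show "\<forall>\<^sub>F h in at_right 0. \<forall>x\<in>{a<..<c}. diff_quot h (u t) x = 0"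
    proof eventually_elim
      case (elim h)
      show ?case
      proof
        fix x assume "x \<in> {a<..<c}"
        then have "x \<in> {a<..<b}" "x + h \<in> {a<..<b}" using elim c by auto
        then have "u t x = 0" "u t (x + h) = 0" using zero[OF t'] \<delta> by auto
        then show "diff_quot h (u t) x = 0" by simp
      qed
    qed
  qed auto
  have sq: "integrable lborel (\<lambda>x. (u t x)\<^sup>2)" "integrable lborel (\<lambda>x. (w x)\<^sup>2)"
    using ut wt by (auto simp: w_def intro: L2_square_integrable)
  have fi: "integrable lborel f" unfolding f_def using sq by simp
  have "AE x in lborel. f x = 0"
  proof (rule dx_inv_Helmholtz_unique_continuation[OF fi _ c(1)])
    show "0 \<le> f x" for x by (simp add: f_def)
    have u0: "u t x = 0" if "x \<in> {a<..<c}" for x by (rule zero[OF t']) (use that \<delta> c in auto)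
    show "AE x in lborel. x \<in> {a<..<c} \<longrightarrow> f x = 0"
      using w0 by eventually_elim (auto simp: f_def u0)
    show "AE x in lborel. x \<in> {a<..<c} \<longrightarrow> dx_inv_Helmholtz f x = 0"
      using eq v0 by eventually_elim (auto simp: u0)
  qed
  then have "(\<integral>x. f x \<partial>lborel) = 0" by (rule integral_eq_zero_AE)
  moreover have "(\<integral>x. f x \<partial>lborel) = (\<integral>x. (u t x)\<^sup>2 \<partial>lborel) + 1/2 * (\<integral>x. (w x)\<^sup>2 \<partial>lborel)"
    unfolding f_def using sq by simp
  moreover have "0 \<le> (\<integral>x. (u t x)\<^sup>2 \<partial>lborel)" "0 \<le> (\<integral>x. (w x)\<^sup>2 \<partial>lborel)" by simp_all
  ultimately show ?thesis unfolding CH_energy_def w_def[symmetric] by linarith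
qed

end

theorem theorem1p3:
  fixes T :: real and u0 :: "real \<Rightarrow> real" and u :: "real \<Rightarrow> real \<Rightarrow> real"
    and \<Omega> :: "(real \<times> real) set"
  assumes "T > 0"
    and "u0 \<in> H1 \<inter> W1inf"
    and "CH_solution T u0 u"
    and "openin (top_of_set (UNIV \<times> {0..T})) \<Omega>"
    and "\<Omega> \<noteq> {}"
    and "\<forall>(x, t)\<in>\<Omega>. u t x = 0"
  shows "\<forall>(x, t)\<in>UNIV \<times> {0..T}. u t x = 0"
proof -
  obtain x1 t1 where xt: "(x1, t1) \<in> \<Omega>" using assms(5) by auto
  from assms(4) obtain e where e: "e > 0" "\<And>x s. s \<in> {0..T} \<Longrightarrow> dist (x, s) (x1, t1) < e \<Longrightarrow> (x, s) \<in> \<Omega>"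
    and t1: "t1 \<in> {0..T}"
    using xt unfolding openin_euclidean_subtopology_iff by fastforce
  define \<rho> where "\<rho> = min (e / 2) (T / 2)"
  have \<rho>: "\<rho> > 0" "\<rho> \<le> e / 2" "\<rho> \<le> T / 2" using e(1) assms(1) by (auto simp: \<rho>_def)
  \<comment> \<open>\<open>t1\<close> may be an endpoint, where the equation is not assumed; move it into the interior.\<close>
  define t where "t = (if t1 \<le> T / 2 then t1 + \<rho> / 2 else t1 - \<rho> / 2)"
  have t: "t \<in> {0<..<T}" "\<bar>t - t1\<bar> = \<rho> / 2" using \<rho> t1 assms(1) by (auto simp: t_def)
  have "CH_energy u t = 0"
  proof (rule CH_zero_on_rectangle[OF assms(1,3) t(1), of "x1 - \<rho>" "x1 + \<rho>" "\<rho> / 2"])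
    fix s x assume s: "s \<in> {0..T}" "\<bar>s - t\<bar> < \<rho> / 2" and x: "x \<in> {x1 - \<rho><..<x1 + \<rho>}"
    have "dist (x, s) (x1, t1) \<le> \<bar>x - x1\<bar> + \<bar>s - t1\<bar>"
      unfolding dist_Pair_Pair dist_real_def by (rule sqrt_sum_squares_le_sum_abs[THEN order_trans]) simp
    also have "\<dots> < e"
    proof -
      have "\<bar>x - x1\<bar> < \<rho>" using x by auto
      moreover have "\<bar>s - t1\<bar> < \<rho>" using s(2) t(2) by linarith
      ultimately show ?thesis using \<rho>(2) by linarith
    qed
    finally have "(x, s) \<in> \<Omega>" by (rule e(2)[OF s(1)])
    then show "u s x = 0" using assms(6) by auto
  qed (use \<rho> in auto)
  then show ?thesis
    using CH_zero_propagates[OF assms(1,3), of t] t(1) by auto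
qed

end
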